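(* Let $\mathbf{K}_X=\mathbf{U}\,\mathrm{diag}(\bm\lambda)\,\mathbf{U}^\top$ and $\mathbf{K}_Y=\mathbf{V}\,\mathrm{diag}(\bm\mu)\,\mathbf{V}^\top$ be two standard kernels of size $n\times n$ with the same weight vector $\mathbf{f}$, let $\mathbf{T}$ be a Haar-distributed random element of the orthogonal group $\mathbb{O}_{n-1}$, let $$\mathtt{CV}=\mathtt{CV}(\mathbf{T})=\mathrm{Tr}\bigl(\mathbf{U}\mathbf{T}\,\mathrm{diag}(\bm\lambda)\,\mathbf{T}^\top\mathbf{U}^\top\,\mathbf{V}\,\mathrm{diag}(\bm\mu)\,\mathbf{V}^\top\bigr),$$ and let $\mathtt{CV}_c=\mathtt{CV}-\mathbb{E}(\mathtt{CV})$. Then $$\mathbb{E}(\mathtt{CV})=(n-1)\,\overline{\bm\lambda}\;\overline{\bm\mu}\qquad (n\ge 2),$$ $$\mathbb{E}(\mathtt{CV}_c^2)=\frac{2(n-1)^2}{(n-2)(n+1)}\;\overline{\bm\lambda_c^2}\;\overline{\bm\mu_c^2}\qquad (n\ge 3),$$ $$\mathbb{E}(\mathtt{CV}_c^3)=\frac{8(n-1)^3}{(n-3)(n-2)(n+1)(n+3)}\;\overline{\bm\lambda_c^3}\;\overline{\bm\mu_c^3}\qquad (n\ge 4),$$ and, for $n\ge 5$, $$\mathbb{E}(\mathtt{CV}_c^4)=\frac{12\,(n-1)^3}{(n-4)(n-3)(n-2)\,n\,(n+1)(n+3)(n+5)}\Bigl\{4(n^2-n+2)\,\overline{\bm\lam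bda_c^4}\;\overline{\bm\mu_c^4}+(n^4+n^3-15n^2-13n+98)\,\bigl(\overline{\bm\lambda_c^2}\bigr)^2\bigl(\overline{\bm\mu_c^2}\bigr)^2-4(2n^2-n-7)\Bigl(\overline{\bm\lambda_c^4}\,\bigl(\overline{\bm\mu_c^2}\bigr)^2+\bigl(\overline{\bm\lambda_c^2}\bigr)^2\,\overline{\bm\mu_c^4}\Bigr)\Bigr\}.$$
   Context: Let $\mathbf{f}=(f_1,\dots,f_n)$ with $f_i>0$ and $\sum_i f_i=1$, and let $\sqrt{\mathbf{f}}=(\sqrt{f_1},\dots,\sqrt{f_n})^\top$. A standard kernel (with weights $\mathbf{f}$) is a real symmetric positive semi-definite $n\times n$ matrix $\mathbf{K}$ with $\mathbf{K}\sqrt{\mathbf{f}}=\mathbf{0}$. (Standard kernels correspond bijectively to squared Euclidean dissimilarity matrices $\mathbf{D}$ via $\mathbf{K}=-\tfrac12\sqrt{\bm\Pi}\,\mathbf{H}\mathbf{D}\mathbf{H}^\top\sqrt{\bm\Pi}$, $\bm\Pi=\mathrm{diag}(\mathbf{f})$, $\mathbf{H}=\mathbf{I}_n-\mathbf{1}_n\mathbf{f}^\top$.) Discarding the trivial eigenvector $\sqrt{\mathbf{f}}$ (eigenvalue $0$), one writes $\mathbf{K}_X=\mathbf{U}\,\mathrm{diag}(\bm\lambda)\,\mathbf{U}^\top$, where $\mathbf{U}\in\mathbb{R}^{n\times(n-1)}$ satisfies $\mathbf{U}^\top\mathbf{U}=\mathbf{I}_{n-1}$, $\mathbf{U}\mathbf{U}^\top=\mathbf{I}_n-\sqrt{\mathbf{f}}\sqrt{\mathbf{f}}^\top$,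 $\mathbf{U}^\top\sqrt{\mathbf{f}}=\mathbf{0}$, and $\bm\lambda=(\lambda_1,\dots,\lambda_{n-1})$ are the remaining eigenvalues $\lambda_1\ge\dots\ge\lambda_{n-1}\ge 0$. Similarly $\mathbf{K}_Y=\mathbf{V}\,\mathrm{diag}(\bm\mu)\,\mathbf{V}^\top$ with the same properties for $\mathbf{V}$ and $\bm\mu=(\mu_1,\dots,\mu_{n-1})$. Spectral moments and centered spectral moments: $\overline{\bm\lambda^q}=\frac1{n-1}\sum_{\alpha=1}^{n-1}\lambda_\alpha^q$, $\overline{\bm\lambda}=\overline{\bm\lambda^1}$, $\overline{\bm\lambda_c^q}=\frac1{n-1}\sum_{\alpha=1}^{n-1}(\lambda_\alpha-\overline{\bm\lambda})^q$, and similarly for $\bm\mu$. Expectations $\mathbb{E}$ are with respect to the normalized invariant Haar (probability) measure on $\mathbb{O}_{n-1}$, the group of real orthogonal $(n-1)\times(n-1)$ matrices ("invariant orthogonal integration"); for $\mathbf{T}=\mathbf{I}$ one has $\mathtt{CV}(\mathbf{I})=\mathrm{Tr}(\mathbf{K}_X\mathbf{K}_Y)$. *)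

theory Defs
  imports "HOL-Probability.Probability"
begin

definition diag :: "real^'m \<Rightarrow> real^'m^'m" where
  "diag v = (\<chi> i j. if i = j then v $ i else 0)"

definition weights :: "real^'n \<Rightarrow> bool" where
  "weights f \<longleftrightarrow> (\<forall>i. 0 < f $ i) \<and> (\<Sum>i\<in>UNIV. f $ i) = 1"

definition sqrt_vec :: "real^'n \<Rightarrow> real^'n" where
  "sqrt_vec f = (\<chi> i. sqrt (f $ i))"

definition standard_kernel :: "real^'n \<Rightarrow> real^'n^'n \<Rightarrow> bool" where
  "standard_kernel f K \<longleftrightarrow>
     transpose K = K \<and> (\<forall>x. 0 \<le> x \<bullet> (K *v x)) \<and> K *v sqrt_vec f = 0"

text \<open>
  The non-trivial part of the eigendecomposition of a standard kernel. The index type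
  \<open>'m\<close> plays the role of $\{1, \ldots, n-1\}$; its linear order is used only to list the
  eigenvalues in decreasing order.
\<close>

definition nontrivial_eigendecomposition ::
    "real^'n \<Rightarrow> real^'n^'n \<Rightarrow> real^('m::{finite,linorder})^'n \<Rightarrow>
     real^('m::{finite,linorder}) \<Rightarrow> bool" where
  "nontrivial_eigendecomposition f K U l \<longleftrightarrow>
     CARD('n) = CARD('m) + 1 \<and>
     transpose U ** U = mat 1 \<and>
     U ** transpose U = mat 1 - (\<chi> i j. sqrt_vec f $ i * sqrt_vec f $ j) \<and>
     transpose U *v sqrt_vec f = 0 \<and>
     (\<forall>i j. i \<le> j \<longrightarrow> l $ j \<le> l $ i) \<and> (\<forall>i. 0 \<le> l $ i) \<and>
     K = U ** diag l ** transpose U"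

definition spectral_moment :: "real^'m \<Rightarrow> nat \<Rightarrow> real" where
  "spectral_moment l q = (\<Sum>i\<in>UNIV. (l $ i) ^ q) / real CARD('m)"

definition centered_spectral_moment :: "real^'m \<Rightarrow> nat \<Rightarrow> real" where
  "centered_spectral_moment l q =
     (\<Sum>i\<in>UNIV. (l $ i - spectral_moment l 1) ^ q) / real CARD('m)"

definition orthogonal_borel :: "(real^'m^'m) measure" where
  "orthogonal_borel = restrict_space borel (Collect orthogonal_matrix)"

text \<open>
  Normalized Haar measure on the orthogonal group: a Borel probability measure invariant
  under left translations. As the group is compact, it is unique, and right invariance follows.
\<close>

definition haar_orthogonal :: "(real^'m^'m) measure \<Rightarrow> bool" where
  "haar_orthogonal H \<longleftrightarrow>
     prob_space H \<and> sets H = sets orthogonal_borel \<and>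
     (\<forall>Q. orthogonal_matrix Q \<longrightarrow> distr H H (\<lambda>T. Q ** T) = H)"

definition haar_distributed :: "'a measure \<Rightarrow> ('a \<Rightarrow> real^'m^'m) \<Rightarrow> bool" where
  "haar_distributed M T \<longleftrightarrow>
     T \<in> measurable M orthogonal_borel \<and> haar_orthogonal (distr M orthogonal_borel T)"

definition CV ::
    "real^'m^'n \<Rightarrow> real^'m \<Rightarrow> real^'m^'n \<Rightarrow> real^'m \<Rightarrow> real^'m^'m \<Rightarrow> real" where
  "CV U l V m T =
     trace (U ** T ** diag l ** transpose T ** transpose U ** V ** diag m ** transpose V)"

end

(*
  S = V^T U T is again Haar distributed and, after centering the eigenvalues to b (from lambda) and
  a (from mu), the centered CV is sum_i a_i q_i, where the q_i are the diagonal entries of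
  Q = S diag(b) S^T. The q_i are exchangeable and sum to 0, so the k-th moment depends on few joint
  moments of the q_i: all follow from E q_1^k, except that for k = 4 also E q_1^2 q_2^2 is needed.

  E q_1^k: by invariance of Haar measure under transposition, q_1 may be replaced by
  sum_i b_i s_i^2 for a column s of S. Its moments are determined by exchangeability, sum_i s_i^2 = 1
  and E h s_i^4 = 3 E h s_i^2 s_j^2 for h not involving s_i and s_j.

  E q_1^2 q_2^2: multiply tr Q^2 = sum_j b_j^2 by q_1^2 and take expectations. The off-diagonal
  terms are reduced to diagonal ones because rotating two rows of S by an angle t rotates the pair
  ((q_i - q_k) / 2, Q_ik) by 2 t.
*)

theory Submission
  imports Defs
begin

section \<open>Exchangeable moments\<close>

text \<open>In degree 4 the index patterns are 4, 31, 22, 211 and 1111. Multiplying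
  \<open>sum q_i = 0\<close> by a product of pattern 3, 21 or 111 gives three linear relations, so
  two moments stay free; degrees 2 and 3 have one relation fewer than patterns, so one stays free.
  For the squared coordinates of a column the sum is 1 instead of 0: the relations are then
  inhomogeneous and, together with the factor 3, determine every moment. The factor 3 is the ratio
  of the averages of \<open>cos^4\<close> and \<open>cos^2 * sin^2\<close> over the circle. The
  transposition is forced by the definition of Haar measure, which grants left invariance only. Left
  multiplication moves each column of S as a vector, whereas \<open>q_1\<close> is built from a
  row.\<close>

lemma sum_split_exceptions:
  fixes f g :: "'i::finite \<Rightarrow> real"
  assumes "\<And>k. k \<notin> S \<Longrightarrow> f k = g k"
  shows "(\<Sum>k\<in>UNIV. f k) = (\<Sum>k\<in>UNIV. g k) + (\<Sum>k\<in>S. f k - g k)"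
proof -
  have "(\<Sum>k\<in>UNIV. f k - g k) = (\<Sum>k\<in>S. f k - g k)"
    by (rule sum.mono_neutral_right) (use assms in auto)
  then show ?thesis by (simp add: sum_subtractf)
qed

abbreviation psum :: "('i::finite \<Rightarrow> real) \<Rightarrow> nat \<Rightarrow> real" where
  "psum w q \<equiv> \<Sum>i\<in>UNIV. w i ^ q"

text \<open>The map \<open>xs ! i\<close> to \<open>ys ! i\<close> is glued to any bijection of the
  complements, which have equal size because the type is finite. It turns invariance under
  permutations into equality of all moments of one pattern.\<close>

lemma exists_bij_map_distinct:
  fixes xs ys :: "'i::finite list"
  assumes "distinct xs" "distinct ys" "length xs = length ys"
  obtains p where "bij p" "map p xs = ys"
proof -
  have b1: "bij_betw (\<lambda>i. xs ! i) {..<length xs} (set xs)"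
    by (rule bij_betw_nth) (use assms in auto)
  have b2: "bij_betw (\<lambda>i. ys ! i) {..<length xs} (set ys)"
    by (rule bij_betw_nth) (use assms in auto)
  define g where "g = (\<lambda>i. ys ! i) \<circ> inv_into {..<length xs} (\<lambda>i. xs ! i)"
  have g: "bij_betw g (set xs) (set ys)"
    unfolding g_def by (rule bij_betw_trans[OF bij_betw_inv_into[OF b1] b2])
  have gx: "g (xs ! i) = ys ! i" if "i < length xs" for i
    unfolding g_def using bij_betw_inv_into_left[OF b1] that by simp
  have "card (- set xs) = card (- set ys)"
    using assms by (simp add: Compl_eq_Diff_UNIV card_Diff_subset distinct_card)
  then obtain h where h: "bij_betw h (- set xs) (- set ys)"
    using finite_same_card_bij by (metis finite_code)
  have "bij_betw (\<lambda>i. if i \<in> set xs then g i else h i) (set xs \<union> - set xs) (set ys \<union> - set ys)"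
    by (rule bij_betw_disjoint_Un) (use g h in auto)
  then have "bij (\<lambda>i. if i \<in> set xs then g i else h i)" by simp
  moreover have "map (\<lambda>i. if i \<in> set xs then g i else h i) xs = ys"
    by (rule nth_equalityI) (use assms gx in auto)
  ultimately show ?thesis using that by blast
qed

text \<open>Models \<open>mom xs\<close> as the expectation of the product of exchangeable variables
  over the list \<open>xs\<close>, a repeated index being a power. With lists, multiplying by one
  more variable is Cons, so \<open>sum_mom\<close> says that the variables add up to the constant
  \<open>total\<close>.\<close>

locale exchangeable_moments =
  fixes mom :: "'i::finite list \<Rightarrow> real" and total :: real
  assumes mom_mset: "\<And>xs ys. mset xs = mset ys \<Longrightarrow> mom xs = mom ys"
    and mom_bij: "\<And>p xs. bij p \<Longrightarrow> mom (map p xs) = mom xs"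
    and sum_mom: "\<And>xs. (\<Sum>i\<in>UNIV. mom (i # xs)) = total * mom xs"
    and mom_Nil: "mom [] = 1"
begin

text \<open>The list \<open>is\<close> is the repetition pattern, given by positions, and
  \<open>xs\<close> and \<open>ys\<close> are two choices of indices that fill it.\<close>

lemma mom_rename:
  assumes "distinct xs" "distinct ys" "length xs = length ys" "\<forall>i\<in>set is. i < length xs"
  shows "mom (map ((!) xs) is) = mom (map ((!) ys) is)"
proof -
  obtain p where p: "bij p" "map p xs = ys"
    using exists_bij_map_distinct assms by blast
  have "map ((!) ys) is = map p (map ((!) xs) is)"
    using p(2) assms(4) by auto
  then show ?thesis using mom_bij[OF p(1)] by metis
qed

text \<open>The digits in these names are the multiplicities of the distinct indices, so there is
  one fact for each pattern up to degree 4.\<close>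

lemma mom_1: "mom [i] = mom [a]"
  using mom_rename[of "[i]" "[a]" "[0]"] by simp
lemma mom_2: "mom [i,i] = mom [a,a]"
  using mom_rename[of "[i]" "[a]" "[0,0]"] by simp
lemma mom_3: "mom [i,i,i] = mom [a,a,a]"
  using mom_rename[of "[i]" "[a]" "[0,0,0]"] by simp
lemma mom_4: "mom [i,i,i,i] = mom [a,a,a,a]"
  using mom_rename[of "[i]" "[a]" "[0,0,0,0]"] by simp

lemma mom_11: "distinct [i,j] \<Longrightarrow> distinct [a,b] \<Longrightarrow> mom [i,j] = mom [a,b]"
  using mom_rename[of "[i,j]" "[a,b]" "[0,1]"] by simp
lemma mom_21: "distinct [i,j] \<Longrightarrow> distinct [a,b] \<Longrightarrow> mom [i,i,j] = mom [a,a,b]"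
  using mom_rename[of "[i,j]" "[a,b]" "[0,0,1]"] by simp
lemma mom_31: "distinct [i,j] \<Longrightarrow> distinct [a,b] \<Longrightarrow> mom [i,i,i,j] = mom [a,a,a,b]"
  using mom_rename[of "[i,j]" "[a,b]" "[0,0,0,1]"] by simp
lemma mom_22: "distinct [i,j] \<Longrightarrow> distinct [a,b] \<Longrightarrow> mom [i,i,j,j] = mom [a,a,b,b]"
  using mom_rename[of "[i,j]" "[a,b]" "[0,0,1,1]"] by simp
lemma mom_111: "distinct [i,j,k] \<Longrightarrow> distinct [a,b,c] \<Longrightarrow> mom [i,j,k] = mom [a,b,c]"
  using mom_rename[of "[i,j,k]" "[a,b,c]" "[0,1,2]"] by simp
lemma mom_211: "distinct [i,j,k] \<Longrightarrow> distinct [a,b,c] \<Longrightarrow> mom [i,i,j,k] = mom [a,a,b,c]"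
  using mom_rename[of "[i,j,k]" "[a,b,c]" "[0,0,1,2]"] by simp
lemma mom_1111: "distinct [i,j,k,l] \<Longrightarrow> distinct [a,b,c,d] \<Longrightarrow> mom [i,j,k,l] = mom [a,b,c,d]"
  using mom_rename[of "[i,j,k,l]" "[a,b,c,d]" "[0,1,2,3]"] by (simp add: numeral_3_eq_3)

lemma N_mom_1: "real CARD('i) * mom [a] = total"
proof -
  have "(\<Sum>i\<in>UNIV. mom [i]) = (\<Sum>i::'i\<in>UNIV. mom [a])"
    by (intro sum.cong refl mom_1)
  then show ?thesis using sum_mom[of "[]"] by (simp add: mom_Nil)
qed

text \<open>This and the next lemmas extend one pattern, named by its digits, by a further index.
  That index either repeats an old one, which gives the exceptional terms, or is new, and then all
  choices give the same moment.\<close>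

lemma sum_mom_1:
  assumes "distinct [a,b]"
  shows "mom [a,a] + (real CARD('i) - 1) * mom [a,b] = total * mom [a]"
proof -
  have "mom [k, a] = mom [a,b]" if "k \<notin> {a}" for k
    by (rule mom_11) (use assms that in auto)
  then have "(\<Sum>i\<in>UNIV. mom (i # [a])) = (\<Sum>i::'i\<in>UNIV. mom [a,b]) + (\<Sum>i\<in>{a}. mom (i # [a]) - mom [a,b])"
    by (rule sum_split_exceptions)
  then show ?thesis unfolding sum_mom by (simp add: algebra_simps)
qed

lemma sum_mom_2:
  assumes "distinct [a,b]"
  shows "mom [a,a,a] + (real CARD('i) - 1) * mom [a,a,b] = total * mom [a,a]"
proof -
  have "mom [k,a,a] = mom [a,a,b]" if "k \<notin> {a}" for k
  proof -
    have "mom [k,a,a] = mom [a,a,k]" by (rule mom_mset) (simp add: add_mset_commute)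
    also have "\<dots> = mom [a,a,b]" by (rule mom_21) (use assms that in auto)
    finally show ?thesis .
  qed
  then have "(\<Sum>i\<in>UNIV. mom (i # [a,a])) = (\<Sum>i::'i\<in>UNIV. mom [a,a,b]) + (\<Sum>i\<in>{a}. mom (i # [a,a]) - mom [a,a,b])"
    by (rule sum_split_exceptions)
  then show ?thesis unfolding sum_mom by (simp add: algebra_simps)
qed

lemma sum_mom_3:
  assumes "distinct [a,b]"
  shows "mom [a,a,a,a] + (real CARD('i) - 1) * mom [a,a,a,b] = total * mom [a,a,a]"
proof -
  have "mom [k,a,a,a] = mom [a,a,a,b]" if "k \<notin> {a}" for k
  proof -
    have "mom [k,a,a,a] = mom [a,a,a,k]" by (rule mom_mset) (simp add: add_mset_commute)
    also have "\<dots> = mom [a,a,a,b]" by (rule mom_31) (use assms that in auto)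
    finally show ?thesis .
  qed
  then have "(\<Sum>i\<in>UNIV. mom (i # [a,a,a])) = (\<Sum>i::'i\<in>UNIV. mom [a,a,a,b])
      + (\<Sum>i\<in>{a}. mom (i # [a,a,a]) - mom [a,a,a,b])"
    by (rule sum_split_exceptions)
  then show ?thesis unfolding sum_mom by (simp add: algebra_simps)
qed

lemma sum_mom_11:
  assumes "distinct [a,b,c]"
  shows "2 * mom [a,a,b] + (real CARD('i) - 2) * mom [a,b,c] = total * mom [a,b]"
proof -
  have "mom [k,a,b] = mom [a,b,c]" if "k \<notin> {a,b}" for k
    by (rule mom_111) (use assms that in auto)
  then have "(\<Sum>i\<in>UNIV. mom (i # [a,b])) = (\<Sum>i::'i\<in>UNIV. mom [a,b,c])
      + (\<Sum>i\<in>{a,b}. mom (i # [a,b]) - mom [a,b,c])"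
    by (rule sum_split_exceptions)
  moreover have "mom [b,a,b] = mom [b,b,a]" by (rule mom_mset) (simp add: add_mset_commute)
  moreover have "mom [b,b,a] = mom [a,a,b]" by (rule mom_21) (use assms in auto)
  ultimately show ?thesis unfolding sum_mom using assms by (simp add: algebra_simps)
qed

lemma sum_mom_21:
  assumes "distinct [a,b,c]"
  shows "mom [a,a,a,b] + mom [a,a,b,b] + (real CARD('i) - 2) * mom [a,a,b,c] = total * mom [a,a,b]"
proof -
  have "mom [k,a,a,b] = mom [a,a,b,c]" if "k \<notin> {a,b}" for k
  proof -
    have "mom [k,a,a,b] = mom [a,a,b,k]" by (rule mom_mset) (simp add: add_mset_commute)
    also have "\<dots> = mom [a,a,b,c]" by (rule mom_211) (use assms that in auto)
    finally show ?thesis .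
  qed
  then have "(\<Sum>i\<in>UNIV. mom (i # [a,a,b])) = (\<Sum>i::'i\<in>UNIV. mom [a,a,b,c])
      + (\<Sum>i\<in>{a,b}. mom (i # [a,a,b]) - mom [a,a,b,c])"
    by (rule sum_split_exceptions)
  moreover have "mom [b,a,a,b] = mom [a,a,b,b]" by (rule mom_mset) (simp add: add_mset_commute)
  ultimately show ?thesis unfolding sum_mom using assms by (simp add: algebra_simps)
qed

lemma sum_mom_111:
  assumes "distinct [a,b,c,d]"
  shows "3 * mom [a,a,b,c] + (real CARD('i) - 3) * mom [a,b,c,d] = total * mom [a,b,c]"
proof -
  have "mom [k,a,b,c] = mom [a,b,c,d]" if "k \<notin> {a,b,c}" for k
    by (rule mom_1111) (use assms that in auto)
  then have "(\<Sum>i\<in>UNIV. mom (i # [a,b,c])) = (\<Sum>i::'i\<in>UNIV. mom [a,b,c,d])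
      + (\<Sum>i\<in>{a,b,c}. mom (i # [a,b,c]) - mom [a,b,c,d])"
    by (rule sum_split_exceptions)
  moreover have "mom [b,a,b,c] = mom [b,b,a,c]" by (rule mom_mset) (simp add: add_mset_commute)
  moreover have "mom [b,b,a,c] = mom [a,a,b,c]" by (rule mom_211) (use assms in auto)
  moreover have "mom [c,a,b,c] = mom [c,c,a,b]" by (rule mom_mset) (simp add: add_mset_commute)
  moreover have "mom [c,c,a,b] = mom [a,a,b,c]" by (rule mom_211) (use assms in auto)
  ultimately show ?thesis unfolding sum_mom using assms by (simp add: algebra_simps)
qed

text \<open>As the weights sum to zero, the value that \<open>mom\<close> takes at generic indices
  drops out, and only the corrections at coinciding indices remain.
  \<open>sum_split_exceptions\<close> isolates them, here and in the next two forms.\<close>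

lemma quadratic_form:
  assumes w: "(\<Sum>i\<in>UNIV. w i) = 0" and "distinct [a,b]"
  shows "(\<Sum>i\<in>UNIV. \<Sum>j\<in>UNIV. w i * w j * mom [i,j]) = (mom [a,a] - mom [a,b]) * psum w 2"
proof -
  have "(\<Sum>j\<in>UNIV. w i * w j * mom [i,j]) = (mom [a,a] - mom [a,b]) * w i ^ 2" for i
  proof -
    have "mom [i,j] = mom [a,b]" if "j \<notin> {i}" for j
      by (rule mom_11) (use assms that in auto)
    then have "(\<Sum>j\<in>UNIV. w i * w j * mom [i,j]) = (\<Sum>j\<in>UNIV. w i * w j * mom [a,b])
       + (\<Sum>j\<in>{i}. w i * w j * mom [i,j] - w i * w j * mom [a,b])"
      by (intro sum_split_exceptions) auto
    also have "(\<Sum>j\<in>UNIV. w i * w j * mom [a,b]) = 0"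
      using w by (simp flip: sum_distrib_left sum_distrib_right)
    finally show ?thesis by (simp add: mom_2[of i a] algebra_simps power2_eq_square)
  qed
  then show ?thesis by (simp flip: sum_distrib_left)
qed

text \<open>The coefficients 1, -3, 2 are the Moebius values of the partition lattice of a
  three-element set, times the number of partitions of each type; all other products of power sums
  contain \<open>psum w 1 = 0\<close>. The proof sums out one index at a time.\<close>

lemma cubic_form:
  assumes w: "(\<Sum>i\<in>UNIV. w i) = 0" and "distinct [a,b,c]"
  shows "(\<Sum>i\<in>UNIV. \<Sum>j\<in>UNIV. \<Sum>k\<in>UNIV. w i * w j * w k * mom [i,j,k]) =
    (mom [a,a,a] - 3 * mom [a,a,b] + 2 * mom [a,b,c]) * psum w 3"
proof -
  define A where "A = mom [a,a,b] - mom [a,b,c]"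
  define B where "B = mom [a,a,a] - mom [a,a,b]"
  have eq: "(\<Sum>k\<in>UNIV. w k * mom [i,i,k]) = w i * B" for i
  proof -
    have "mom [i,i,k] = mom [a,a,b]" if "k \<notin> {i}" for k
      by (rule mom_21) (use assms that in auto)
    then have "(\<Sum>k\<in>UNIV. w k * mom [i,i,k]) = (\<Sum>k\<in>UNIV. w k * mom [a,a,b])
       + (\<Sum>k\<in>{i}. w k * mom [i,i,k] - w k * mom [a,a,b])"
      by (intro sum_split_exceptions) auto
    then show ?thesis using w by (simp add: B_def mom_3[of i a] algebra_simps flip: sum_distrib_left sum_distrib_right)
  qed
  have neq: "(\<Sum>k\<in>UNIV. w k * mom [i,j,k]) = (w i + w j) * A" if "i \<noteq> j" for i j
  proof -
    have "mom [i,j,k] = mom [a,b,c]" if "k \<notin> {i,j}" for k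
      by (rule mom_111) (use assms \<open>i \<noteq> j\<close> that in auto)
    then have "(\<Sum>k\<in>UNIV. w k * mom [i,j,k]) = (\<Sum>k\<in>UNIV. w k * mom [a,b,c])
       + (\<Sum>k\<in>{i,j}. w k * mom [i,j,k] - w k * mom [a,b,c])"
      by (intro sum_split_exceptions) auto
    moreover have "mom [i,j,i] = mom [i,i,j]" by (rule mom_mset) (simp add: add_mset_commute)
    moreover have "mom [i,j,j] = mom [j,j,i]" by (rule mom_mset) (simp add: add_mset_commute)
    moreover have "mom [i,i,j] = mom [a,a,b]" by (rule mom_21) (use assms that in auto)
    moreover have "mom [j,j,i] = mom [a,a,b]" by (rule mom_21) (use assms that in auto)
    ultimately show ?thesis using w \<open>i \<noteq> j\<close>
      by (simp add: A_def algebra_simps flip: sum_distrib_left sum_distrib_right)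
  qed
  have "(\<Sum>j\<in>UNIV. \<Sum>k\<in>UNIV. w i * w j * w k * mom [i,j,k]) = (B - 2 * A) * w i ^ 3
      + A * w i * psum w 2" for i
  proof -
    have "(\<Sum>j\<in>UNIV. w i * w j * (\<Sum>k\<in>UNIV. w k * mom [i,j,k])) =
       (\<Sum>j\<in>UNIV. w i * w j * ((w i + w j) * A))
       + (\<Sum>j\<in>{i}. w i * w j * (\<Sum>k\<in>UNIV. w k * mom [i,j,k]) - w i * w j * ((w i + w j) * A))"
      by (intro sum_split_exceptions) (auto simp: neq)
    also have "(\<Sum>j\<in>UNIV. w i * w j * ((w i + w j) * A)) = (\<Sum>j\<in>UNIV. w j * (A * w i^2) + w j ^ 2 * (A * w i))"
      by (rule sum.cong) (auto simp: algebra_simps power2_eq_square)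
    also have "\<dots> = A * w i * psum w 2"
      using w by (simp add: sum.distrib flip: sum_distrib_right)
    finally show ?thesis
      by (simp add: eq sum_distrib_left algebra_simps power2_eq_square power3_eq_cube)
  qed
  then have "(\<Sum>i\<in>UNIV. \<Sum>j\<in>UNIV. \<Sum>k\<in>UNIV. w i * w j * w k * mom [i,j,k]) =
     (\<Sum>i\<in>UNIV. (B - 2 * A) * w i ^ 3 + w i * (A * psum w 2))"
    by (simp add: mult_ac)
  also have "\<dots> = (B - 2 * A) * psum w 3"
    using w by (simp add: sum.distrib flip: sum_distrib_left sum_distrib_right)
  finally show ?thesis by (simp add: A_def B_def algebra_simps)
qed

text \<open>Again Moebius inversion over set partitions: besides \<open>psum w 4\<close> only the
  three partitions into two pairs avoid the factor \<open>psum w 1\<close>, whence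
  \<open>3 * (psum w 2)^2\<close>.\<close>

lemma quartic_form:
  assumes w: "(\<Sum>i\<in>UNIV. w i) = 0" and "distinct [a,b,c,d]"
  shows "(\<Sum>i\<in>UNIV. \<Sum>j\<in>UNIV. \<Sum>k\<in>UNIV. \<Sum>l\<in>UNIV. w i * w j * w k * w l * mom [i,j,k,l]) =
    (mom [a,a,a,a] - 4 * mom [a,a,a,b] - 3 * mom [a,a,b,b] + 12 * mom [a,a,b,c] - 6 * mom [a,b,c,d]) * psum w 4
    + 3 * (mom [a,a,b,b] - 2 * mom [a,a,b,c] + mom [a,b,c,d]) * (psum w 2)^2"
proof -
  \<comment> \<open>Each of these constants is the change in a moment when a generic last index is
    made equal to an earlier one.\<close>
  define A where "A = mom [a,a,b,c] - mom [a,b,c,d]"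
  define B where "B = mom [a,a,a,b] - mom [a,a,b,c]"
  define C where "C = mom [a,a,b,b] - mom [a,a,b,c]"
  define D where "D = mom [a,a,a,a] - mom [a,a,a,b]"
  define F where "F i j k = (\<Sum>l\<in>UNIV. w l * mom [i,j,k,l])" for i j k
  have F_mset: "F i j k = F i' j' k'" if "mset [i,j,k] = mset [i',j',k']" for i j k i' j' k'
  proof -
    have "mom ([i,j,k] @ [l]) = mom ([i',j',k'] @ [l])" for l
      by (rule mom_mset) (simp only: mset_append that)
    then show ?thesis by (simp add: F_def)
  qed
  have F3: "F i i i = w i * D" for i
  proof -
    have "mom [i,i,i,l] = mom [a,a,a,b]" if "l \<notin> {i}" for l
      by (rule mom_31) (use assms that in auto)
    then have "F i i i = (\<Sum>l\<in>UNIV. w l * mom [a,a,a,b])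
       + (\<Sum>l\<in>{i}. w l * mom [i,i,i,l] - w l * mom [a,a,a,b])"
      unfolding F_def by (intro sum_split_exceptions) auto
    then show ?thesis using w
      by (simp add: D_def mom_4[of i a] algebra_simps flip: sum_distrib_left sum_distrib_right)
  qed
  have F21: "F i i k = w i * B + w k * C" if "i \<noteq> k" for i k
  proof -
    have "mom [i,i,k,l] = mom [a,a,b,c]" if "l \<notin> {i,k}" for l
      by (rule mom_211) (use assms \<open>i \<noteq> k\<close> that in auto)
    then have "F i i k = (\<Sum>l\<in>UNIV. w l * mom [a,a,b,c])
       + (\<Sum>l\<in>{i,k}. w l * mom [i,i,k,l] - w l * mom [a,a,b,c])"
      unfolding F_def by (intro sum_split_exceptions) auto
    moreover have "mom [i,i,k,i] = mom [i,i,i,k]" by (rule mom_mset) (simp add: add_mset_commute)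
    moreover have "mom [i,i,i,k] = mom [a,a,a,b]" by (rule mom_31) (use assms that in auto)
    moreover have "mom [i,i,k,k] = mom [a,a,b,b]" by (rule mom_22) (use assms that in auto)
    ultimately show ?thesis using w \<open>i \<noteq> k\<close>
      by (simp add: B_def C_def algebra_simps flip: sum_distrib_left sum_distrib_right)
  qed
  have F111: "F i j k = (w i + w j + w k) * A" if "distinct [i,j,k]" for i j k
  proof -
    have "mom [i,j,k,l] = mom [a,b,c,d]" if "l \<notin> {i,j,k}" for l
      by (rule mom_1111) (use assms \<open>distinct [i,j,k]\<close> that in auto)
    then have "F i j k = (\<Sum>l\<in>UNIV. w l * mom [a,b,c,d])
       + (\<Sum>l\<in>{i,j,k}. w l * mom [i,j,k,l] - w l * mom [a,b,c,d])"
      unfolding F_def by (intro sum_split_exceptions) auto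
    moreover have "mom [i,j,k,i] = mom [i,i,j,k]" by (rule mom_mset) (simp add: add_mset_commute)
    moreover have "mom [i,j,k,j] = mom [j,j,i,k]" by (rule mom_mset) (simp add: add_mset_commute)
    moreover have "mom [i,j,k,k] = mom [k,k,i,j]" by (rule mom_mset) (simp add: add_mset_commute)
    moreover have "mom [i,i,j,k] = mom [a,a,b,c]" by (rule mom_211) (use assms that in auto)
    moreover have "mom [j,j,i,k] = mom [a,a,b,c]" by (rule mom_211) (use assms that in auto)
    moreover have "mom [k,k,i,j] = mom [a,a,b,c]" by (rule mom_211) (use assms that in auto)
    ultimately show ?thesis using w that
      by (simp add: A_def algebra_simps flip: sum_distrib_left sum_distrib_right)
  qed
  \<comment> \<open>The third index is summed out the same way: the formula for distinct indices is
    used for all \<open>k\<close> and then corrected where \<open>k\<close> meets \<open>i\<close>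
    or \<open>j\<close>. Now \<open>psum w 2\<close> appears, as \<open>F\<close> is itself linear
    in the weights.\<close>
  define G where "G i j = (\<Sum>k\<in>UNIV. w k * F i j k)" for i j
  have G2: "G i i = (D - B - C) * w i ^ 2 + C * psum w 2" for i
  proof -
    have "G i i = (\<Sum>k\<in>UNIV. w k * (w i * B + w k * C))
       + (\<Sum>k\<in>{i}. w k * F i i k - w k * (w i * B + w k * C))"
      unfolding G_def by (intro sum_split_exceptions) (auto simp: F21)
    also have "(\<Sum>k\<in>UNIV. w k * (w i * B + w k * C)) = (\<Sum>k\<in>UNIV. w k * (w i * B) + w k^2 * C)"
      by (simp add: algebra_simps power2_eq_square)
    also have "\<dots> = C * psum w 2"
      using w by (simp add: sum.distrib flip: sum_distrib_right)
    finally show ?thesis by (simp add: F3 algebra_simps power2_eq_square)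
  qed
  have G11: "G i j = (w i ^ 2 + w j ^ 2) * (B - 2 * A) + w i * w j * (2 * C - 2 * A) + A * psum w 2"
    if "i \<noteq> j" for i j
  proof -
    have "F i j k = (w i + w j + w k) * A" if "k \<notin> {i,j}" for k
      by (rule F111) (use that \<open>i \<noteq> j\<close> in auto)
    then have "G i j = (\<Sum>k\<in>UNIV. w k * ((w i + w j + w k) * A))
       + (\<Sum>k\<in>{i,j}. w k * F i j k - w k * ((w i + w j + w k) * A))"
      unfolding G_def by (intro sum_split_exceptions) auto
    also have "(\<Sum>k\<in>UNIV. w k * ((w i + w j + w k) * A)) = (\<Sum>k\<in>UNIV. w k * ((w i + w j) * A) + w k^2 * A)"
      by (simp add: algebra_simps power2_eq_square)
    also have "\<dots> = A * psum w 2"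
      using w by (simp add: sum.distrib flip: sum_distrib_right)
    finally have "G i j = A * psum w 2 + (\<Sum>k\<in>{i,j}. w k * F i j k - w k * ((w i + w j + w k) * A))" .
    moreover have "F i j i = w i * B + w j * C"
      using F21[of i j] F_mset[of i j i i i j] \<open>i \<noteq> j\<close> by simp
    moreover have "F i j j = w j * B + w i * C"
      using F21[of j i] F_mset[of i j j j j i] \<open>i \<noteq> j\<close> by (simp add: add_mset_commute)
    ultimately show ?thesis using \<open>i \<noteq> j\<close>
      by (simp add: algebra_simps power2_eq_square)
  qed
  have H: "(\<Sum>j\<in>UNIV. w j * G i j) = w i * ((2 * C - 2 * A) * psum w 2 + C * psum w 2 - A * psum w 2)
    + (D - B - C - (2 * (B - 2 * A) + (2 * C - 2 * A))) * w i ^ 3 + (B - 2 * A) * psum w 3" for i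
  proof -
    define g where "g j = (w i ^ 2 + w j ^ 2) * (B - 2 * A) + w i * w j * (2 * C - 2 * A) + A * psum w 2" for j
    have "(\<Sum>j\<in>UNIV. w j * G i j) = (\<Sum>j\<in>UNIV. w j * g j) + (\<Sum>j\<in>{i}. w j * G i j - w j * g j)"
      by (intro sum_split_exceptions) (auto simp: G11 g_def)
    also have "(\<Sum>j\<in>UNIV. w j * g j) =
       (\<Sum>j\<in>UNIV. w j * (w i ^ 2 * (B - 2 * A) + A * psum w 2) + w j ^ 3 * (B - 2 * A) + w j ^ 2 * (w i * (2 * C - 2 * A)))"
      unfolding g_def by (intro sum.cong refl) (simp add: algebra_simps power2_eq_square power3_eq_cube)
    also have "\<dots> = psum w 3 * (B - 2 * A) + psum w 2 * (w i * (2 * C - 2 * A))"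
      using w by (simp add: sum.distrib flip: sum_distrib_right)
    finally show ?thesis by (simp add: G2 g_def algebra_simps power2_eq_square power3_eq_cube)
  qed
  have "(\<Sum>i\<in>UNIV. \<Sum>j\<in>UNIV. \<Sum>k\<in>UNIV. \<Sum>l\<in>UNIV. w i * w j * w k * w l * mom [i,j,k,l]) =
     (\<Sum>i\<in>UNIV. w i * (\<Sum>j\<in>UNIV. w j * G i j))"
    unfolding F_def G_def by (simp add: sum_distrib_left mult_ac)
  also have "\<dots> = (\<Sum>i\<in>UNIV. w i ^ 2 * ((2 * C - 2 * A) * psum w 2 + C * psum w 2 - A * psum w 2)
    + w i ^ 4 * (D - B - C - (2 * (B - 2 * A) + (2 * C - 2 * A))) + w i * ((B - 2 * A) * psum w 3))"
    unfolding H by (intro sum.cong refl)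
      (simp add: algebra_simps power2_eq_square power3_eq_cube power4_eq_xxxx)
  also have "\<dots> = psum w 2 * ((2 * C - 2 * A) * psum w 2 + C * psum w 2 - A * psum w 2)
    + psum w 4 * (D - B - C - (2 * (B - 2 * A) + (2 * C - 2 * A)))"
    using w by (simp add: sum.distrib flip: sum_distrib_right)
  finally show ?thesis
    by (simp add: A_def B_def C_def D_def algebra_simps power2_eq_square)
qed

end

section \<open>Haar measure on the orthogonal group\<close>

locale haar =
  fixes H :: "(real^'m^'m) measure"
  assumes haar: "haar_orthogonal H"
begin

sublocale prob_space H
  using haar by (simp add: haar_orthogonal_def)

lemma sets_H: "sets H = sets orthogonal_borel"
  using haar by (simp add: haar_orthogonal_def)

lemma space_H: "space H = Collect orthogonal_matrix"
  using sets_eq_imp_space_eq[OF sets_H] by (simp add: orthogonal_borel_def space_restrict_space)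

lemma measurable_H:
  fixes f :: "real^'m^'m \<Rightarrow> 'c::topological_space"
  assumes "continuous_on UNIV f"
  shows "f \<in> borel_measurable H"
proof -
  have "f \<in> borel_measurable orthogonal_borel"
    unfolding orthogonal_borel_def
    by (intro measurable_restrict_space1 borel_measurable_continuous_onI assms)
  then show ?thesis by (simp cong: measurable_cong_sets add: sets_H)
qed

text \<open>Compactness of the orthogonal group. It reduces every later integrability obligation to
  continuity.\<close>

lemma bounded_H:
  fixes f :: "real^'m^'m \<Rightarrow> real"
  assumes "continuous_on UNIV f"
  obtains B where "\<And>S. orthogonal_matrix S \<Longrightarrow> \<bar>f S\<bar> \<le> B"
proof -
  have "norm S \<le> real CARD('m)" if "orthogonal_matrix S" for S :: "real^'m^'m"
  proof -
    have "norm (S $ i) = 1" for i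
      using that by (simp add: orthogonal_matrix_orthonormal_rows row_def vec_lambda_eta)
    then show ?thesis
      using L2_set_le_sum[of UNIV "\<lambda>i. norm (S $ i)"] by (simp add: norm_vec_def)
  qed
  then have "bounded (Collect orthogonal_matrix :: (real^'m^'m) set)"
    unfolding bounded_iff by blast
  moreover have "closed (Collect orthogonal_matrix :: (real^'m^'m) set)"
    unfolding orthogonal_matrix matrix_matrix_mult_def transpose_def
    by (intro closed_Collect_eq continuous_intros)
  ultimately have "compact (Collect orthogonal_matrix :: (real^'m^'m) set)"
    by (simp add: compact_eq_bounded_closed)
  then have "compact (f ` Collect orthogonal_matrix)"
    by (intro compact_continuous_image continuous_on_subset[OF assms]) auto
  then have "bounded (f ` Collect orthogonal_matrix)"
    by (rule compact_imp_bounded)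
  then show ?thesis
    unfolding bounded_iff using that by (auto simp: image_iff)
qed

lemma integrable_H:
  fixes f :: "real^'m^'m \<Rightarrow> real"
  assumes "continuous_on UNIV f"
  shows "integrable H f"
proof -
  obtain B where "\<And>S. orthogonal_matrix S \<Longrightarrow> \<bar>f S\<bar> \<le> B"
    using bounded_H[OF assms] by blast
  then show ?thesis
    by (intro integrable_const_bound[where B=B] measurable_H assms) (auto simp: space_H)
qed

abbreviation E :: "(real^'m^'m \<Rightarrow> real) \<Rightarrow> real" where
  "E f \<equiv> integral\<^sup>L H f"

lemma E_left:
  fixes f :: "real^'m^'m \<Rightarrow> real"
  assumes f: "continuous_on UNIV f" and Q: "orthogonal_matrix Q"
  shows "E (\<lambda>S. f (Q ** S)) = E f"
proof -
  have "continuous_on UNIV (\<lambda>T. Q ** T)"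
    unfolding matrix_matrix_mult_def by (intro continuous_intros)
  from measurable_H[OF this] have "(\<lambda>T. Q ** T) \<in> measurable H orthogonal_borel"
    unfolding orthogonal_borel_def
    by (intro measurable_restrict_space2) (auto simp: space_H Q orthogonal_matrix_mul)
  then have m: "(\<lambda>T. Q ** T) \<in> measurable H H"
    by (simp cong: measurable_cong_sets add: sets_H)
  have "E f = integral\<^sup>L (distr H H (\<lambda>T. Q ** T)) f"
    using haar Q by (simp add: haar_orthogonal_def)
  also have "\<dots> = E (\<lambda>S. f (Q ** S))"
    by (rule integral_distr[OF m measurable_H[OF f]])
  finally show ?thesis by simp
qed

text \<open>
  By left invariance, averaging \<open>f (transpose S ** T)\<close> over \<open>T\<close> first gives the right-hand side, and
  averaging over \<open>S\<close> first gives the left-hand side.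
\<close>

lemma E_transpose:
  fixes f :: "real^'m^'m \<Rightarrow> real"
  assumes f: "continuous_on UNIV f"
  shows "E (\<lambda>S. f (transpose S)) = E f"
proof -
  interpret HH: pair_prob_space H H ..
  have t: "continuous_on UNIV (transpose :: real^'m^'m \<Rightarrow> _)"
    unfolding transpose_def by (intro continuous_intros)
  have "continuous_on UNIV (\<lambda>p::(real^'m^'m) \<times> (real^'m^'m). f (transpose (fst p) ** snd p))"
    unfolding matrix_matrix_mult_def transpose_def
    by (intro continuous_on_compose2[OF f] continuous_intros) auto
  then have "(\<lambda>p. f (transpose (fst p) ** snd p)) \<in> borel_measurable (borel :: ((real^'m^'m) \<times> (real^'m^'m)) measure)"
    by (rule borel_measurable_continuous_onI)
  \<comment> \<open>\<open>borel_prod\<close> identifies the product of the Borel sigma-algebras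
    with that of the product space, so joint continuity yields joint measurability.\<close>
  moreover have "(\<lambda>p. p) \<in> measurable (H \<Otimes>\<^sub>M H) (borel :: ((real^'m^'m) \<times> (real^'m^'m)) measure)"
  proof -
    have "(\<lambda>S. S) \<in> borel_measurable H" by (intro measurable_H continuous_on_id)
    then have "fst \<in> borel_measurable (H \<Otimes>\<^sub>M H)" "snd \<in> borel_measurable (H \<Otimes>\<^sub>M H)"
      using measurable_compose[OF measurable_fst, of "\<lambda>S. S" H borel H]
        measurable_compose[OF measurable_snd, of "\<lambda>S. S" H borel H] by simp_all
    from measurable_Pair[OF this] show ?thesis unfolding borel_prod[symmetric] by simp
  qed
  ultimately have meas: "(\<lambda>p. f (transpose (fst p) ** snd p)) \<in> borel_measurable (H \<Otimes>\<^sub>M H)"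
    by (rule measurable_compose[rotated])
  obtain B where B: "\<And>S. orthogonal_matrix S \<Longrightarrow> \<bar>f S\<bar> \<le> B"
    using bounded_H[OF f] by blast
  have int: "integrable (H \<Otimes>\<^sub>M H) (\<lambda>(S, T). f (transpose S ** T))"
    by (intro HH.integrable_const_bound[where B=B])
      (use meas B in \<open>auto simp: space_pair_measure space_H case_prod_beta orthogonal_matrix_mul\<close>)
  have "E f = (\<integral>S. (\<integral>T. f (transpose S ** T) \<partial>H) \<partial>H)"
  proof -
    have "(\<integral>S. (\<integral>T. f (transpose S ** T) \<partial>H) \<partial>H) = (\<integral>S. E f \<partial>H)"
      by (rule Bochner_Integration.integral_cong[OF refl E_left[OF f]]) (simp add: space_H)
    then show ?thesis by (simp add: prob_space)
  qed
  also have "\<dots> = (\<integral>T. (\<integral>S. f (transpose S ** T) \<partial>H) \<partial>H)"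
    using HH.Fubini_integral[OF int] by simp
  also have "\<dots> = (\<integral>T. E (\<lambda>S. f (transpose S)) \<partial>H)"
  proof (rule Bochner_Integration.integral_cong[OF refl])
    fix T assume "T \<in> space H"
    then have T: "orthogonal_matrix (transpose T)" by (simp add: space_H)
    have "(\<integral>S. f (transpose S ** T) \<partial>H) = (\<integral>S. f (transpose (transpose T ** S)) \<partial>H)"
      by (simp add: matrix_transpose_mul)
    also have "\<dots> = E (\<lambda>S. f (transpose S))"
      by (rule E_left[OF _ T]) (intro continuous_on_compose2[OF f] t, auto)
    finally show "(\<integral>S. f (transpose S ** T) \<partial>H) = E (\<lambda>S. f (transpose S))" .
  qed
  finally show ?thesis by (simp add: prob_space)
qed

end

section \<open>Reflections and permutations of coordinates\<close>

text \<open>For \<open>c = cos t\<close> and \<open>s = sin t\<close> this is the reflection of the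
  plane of coordinates \<open>i\<close> and \<open>k\<close> in the line at angle
  \<open>t / 2\<close>. It is symmetric, hence its own inverse.\<close>

definition plane_reflection :: "real \<Rightarrow> real \<Rightarrow> 'm \<Rightarrow> 'm \<Rightarrow> real^'m^'m" where
  "plane_reflection c s i k = (\<chi> a b.
     if a = i then (if b = i then c else if b = k then s else 0)
     else if a = k then (if b = i then s else if b = k then - c else 0)
     else if a = b then 1 else 0)"

lemma plane_reflection_mult:
  fixes S :: "real^'m^'m"
  assumes "i \<noteq> k"
  shows "(plane_reflection c s i k ** S) $ a $ b =
    (if a = i then c * S $ i $ b + s * S $ k $ b
     else if a = k then s * S $ i $ b - c * S $ k $ b else S $ a $ b)"
proof -
  have two: "(\<Sum>l\<in>UNIV. (if l = i then u else if l = k then v else 0) * S $ l $ b) =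
     u * S $ i $ b + v * S $ k $ b" for u v
  proof -
    have "(\<Sum>l\<in>UNIV. (if l = i then u else if l = k then v else 0) * S $ l $ b) =
      (\<Sum>l\<in>{i,k}. (if l = i then u else if l = k then v else 0) * S $ l $ b)"
      by (rule sum.mono_neutral_right) auto
    then show ?thesis using assms by simp
  qed
  have one: "(\<Sum>l\<in>UNIV. (if a = l then 1 else 0) * S $ l $ b) = S $ a $ b"
    by (simp add: if_distrib[of "\<lambda>x. x * _"] cong: if_cong)
  show ?thesis
    using two[of c s] two[of s "- c"] one assms
    by (simp add: matrix_matrix_mult_def plane_reflection_def)
qed

lemma orthogonal_plane_reflection:
  assumes "i \<noteq> k" "c\<^sup>2 + s\<^sup>2 = 1"
  shows "orthogonal_matrix (plane_reflection c s i k)"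
proof -
  have "transpose (plane_reflection c s i k) = plane_reflection c s i k"
    using assms(1) by (simp add: transpose_def plane_reflection_def vec_eq_iff)
  moreover have "plane_reflection c s i k ** plane_reflection c s i k = mat 1"
    using assms by (simp add: vec_eq_iff plane_reflection_mult[OF assms(1)])
      (auto simp: plane_reflection_def mat_def power2_eq_square algebra_simps)
  ultimately show ?thesis by (simp add: orthogonal_matrix)
qed

definition permutation_matrix :: "('m \<Rightarrow> 'm) \<Rightarrow> real^'m^'m" where
  "permutation_matrix p = (\<chi> a b. if b = p a then 1 else 0)"

lemma permutation_matrix_mult: "(permutation_matrix p ** S) $ a = S $ p a"
  by (simp add: permutation_matrix_def matrix_matrix_mult_def vec_eq_iff
      if_distrib[of "\<lambda>x. x * _"] cong: if_cong)

lemma orthogonal_permutation_matrix: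
  assumes "bij p"
  shows "orthogonal_matrix (permutation_matrix p :: real^'m^'m)"
proof -
  have "permutation_matrix p ** transpose (permutation_matrix p) = (mat 1 :: real^'m^'m)"
    using bij_is_inj[OF assms] unfolding vec_eq_iff permutation_matrix_mult
    by (auto simp: transpose_def permutation_matrix_def mat_def inj_eq)
  then have "orthogonal_matrix (transpose (permutation_matrix p :: real^'m^'m))"
    unfolding orthogonal_matrix by simp
  then show ?thesis by simp
qed

lemma continuous_on_prod_list:
  fixes x :: "'i \<Rightarrow> 'a::topological_space \<Rightarrow> real"
  assumes "\<And>i. continuous_on A (x i)"
  shows "continuous_on A (\<lambda>S. \<Prod>i\<leftarrow>is. x i S)"
  by (induction "is") (auto intro!: continuous_intros assms)

text \<open>
  The orthogonal group rotates the pair of functions \<open>(x, y)\<close> without changing \<open>h\<close>; reflections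
  are used instead of rotations because they include both the swap of \<open>x\<close> and \<open>y\<close> and the sign changes.
\<close>

definition reflective ::
  "(real^'m^'m \<Rightarrow> real) \<Rightarrow> (real^'m^'m \<Rightarrow> real) \<Rightarrow> (real^'m^'m \<Rightarrow> real) \<Rightarrow> bool" where
  "reflective h x y \<longleftrightarrow> (\<forall>c s. c\<^sup>2 + s\<^sup>2 = 1 \<longrightarrow> (\<exists>R. orthogonal_matrix R \<and>
     (\<forall>S. h (R ** S) = h S \<and> x (R ** S) = c * x S + s * y S \<and> y (R ** S) = s * x S - c * y S)))"

section \<open>Haar expectations of exchangeable products and powers of sums\<close>

context haar
begin

lemma E_sum:
  assumes "\<And>i. i \<in> I \<Longrightarrow> continuous_on UNIV (f i)"
  shows "E (\<lambda>S. \<Sum>i\<in>I. f i S) = (\<Sum>i\<in>I. E (f i))"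
  by (rule Bochner_Integration.integral_sum) (intro integrable_H assms)

text \<open>Exchangeability is left invariance under permutation matrices.\<close>

lemma exchangeable_moments_E:
  fixes x :: "'m \<Rightarrow> real^'m^'m \<Rightarrow> real"
  assumes cont: "\<And>i. continuous_on UNIV (x i)"
    and perm: "\<And>p i S. bij p \<Longrightarrow> x i (permutation_matrix p ** S) = x (p i) S"
    and total: "\<And>S. orthogonal_matrix S \<Longrightarrow> (\<Sum>i\<in>UNIV. x i S) = t"
  shows "exchangeable_moments (\<lambda>is. E (\<lambda>S. \<Prod>i\<leftarrow>is. x i S)) t"
proof
  fix xs ys :: "'m list" assume eq: "mset xs = mset ys"
  have "(\<Prod>i\<leftarrow>xs. x i S) = (\<Prod>i\<leftarrow>ys. x i S)" for S
    using eq by (metis mset_map prod_mset_prod_list)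
  then show "E (\<lambda>S. \<Prod>i\<leftarrow>xs. x i S) = E (\<lambda>S. \<Prod>i\<leftarrow>ys. x i S)" by simp
next
  fix p :: "'m \<Rightarrow> 'm" and xs assume p: "bij p"
  have "E (\<lambda>S. \<Prod>i\<leftarrow>xs. x i S) = E (\<lambda>S. \<Prod>i\<leftarrow>xs. x i (permutation_matrix p ** S))"
    by (rule E_left[symmetric, OF continuous_on_prod_list[OF cont] orthogonal_permutation_matrix[OF p]])
  then show "E (\<lambda>S. \<Prod>i\<leftarrow>map p xs. x i S) = E (\<lambda>S. \<Prod>i\<leftarrow>xs. x i S)"
    by (simp add: perm[OF p] comp_def)
next
  fix xs
  have "(\<Sum>i\<in>UNIV. E (\<lambda>S. \<Prod>i\<leftarrow>i # xs. x i S)) = E (\<lambda>S. \<Sum>i\<in>UNIV. \<Prod>i\<leftarrow>i # xs. x i S)"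
    by (rule E_sum[symmetric]) (intro continuous_on_prod_list cont)
  also have "\<dots> = E (\<lambda>S. t * (\<Prod>i\<leftarrow>xs. x i S))"
    by (rule Bochner_Integration.integral_cong[OF refl])
      (simp add: space_H flip: sum_distrib_right total)
  finally show "(\<Sum>i\<in>UNIV. E (\<lambda>S. \<Prod>i\<leftarrow>i # xs. x i S)) = t * E (\<lambda>S. \<Prod>i\<leftarrow>xs. x i S)"
    by simp
next
  show "E (\<lambda>S. \<Prod>i\<leftarrow>[]. x i S) = 1" by (simp add: prob_space)
qed

lemma E_sum_power2:
  fixes x :: "'m \<Rightarrow> real^'m^'m \<Rightarrow> real"
  assumes cont: "\<And>i. continuous_on UNIV (x i)"
  shows "E (\<lambda>S. (\<Sum>i\<in>UNIV. w i * x i S) ^ 2) =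
    (\<Sum>i\<in>UNIV. \<Sum>j\<in>UNIV. w i * w j * E (\<lambda>S. \<Prod>i\<leftarrow>[i,j]. x i S))"
proof -
  have "(\<Sum>i\<in>UNIV. w i * x i S) ^ 2 =
     (\<Sum>i\<in>UNIV. \<Sum>j\<in>UNIV. w i * w j * (\<Prod>i\<leftarrow>[i,j]. x i S))" for S
    by (simp add: power2_eq_square sum_product mult_ac)
  then show ?thesis
    by (simp only:) (simp add: E_sum continuous_intros cont)
qed

lemma E_sum_power3:
  fixes x :: "'m \<Rightarrow> real^'m^'m \<Rightarrow> real"
  assumes cont: "\<And>i. continuous_on UNIV (x i)"
  shows "E (\<lambda>S. (\<Sum>i\<in>UNIV. w i * x i S) ^ 3) =
    (\<Sum>i\<in>UNIV. \<Sum>j\<in>UNIV. \<Sum>k\<in>UNIV. w i * w j * w k * E (\<lambda>S. \<Prod>i\<leftarrow>[i,j,k]. x i S))"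
proof -
  have "(\<Sum>i\<in>UNIV. w i * x i S) ^ 3 =
     (\<Sum>i\<in>UNIV. \<Sum>j\<in>UNIV. \<Sum>k\<in>UNIV. w i * w j * w k * (\<Prod>i\<leftarrow>[i,j,k]. x i S))" for S
    by (simp add: power3_eq_cube sum_distrib_left sum_distrib_right mult_ac)
  then show ?thesis
    by (simp only:) (simp add: E_sum continuous_intros cont)
qed

lemma E_sum_power4:
  fixes x :: "'m \<Rightarrow> real^'m^'m \<Rightarrow> real"
  assumes cont: "\<And>i. continuous_on UNIV (x i)"
  shows "E (\<lambda>S. (\<Sum>i\<in>UNIV. w i * x i S) ^ 4) =
    (\<Sum>i\<in>UNIV. \<Sum>j\<in>UNIV. \<Sum>k\<in>UNIV. \<Sum>l\<in>UNIV. w i * w j * w k * w l * E (\<lambda>S. \<Prod>i\<leftarrow>[i,j,k,l]. x i S))"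
proof -
  have "(\<Sum>i\<in>UNIV. w i * x i S) ^ 4 =
     (\<Sum>i\<in>UNIV. \<Sum>j\<in>UNIV. \<Sum>k\<in>UNIV. \<Sum>l\<in>UNIV. w i * w j * w k * w l * (\<Prod>i\<leftarrow>[i,j,k,l]. x i S))" for S
    by (simp add: power4_eq_xxxx sum_distrib_left sum_distrib_right mult_ac)
  then show ?thesis
    by (simp only:) (simp add: E_sum continuous_intros cont)
qed

section \<open>Consequences of reflection invariance of a pair of functions\<close>

context
  fixes h x y :: "real^'m^'m \<Rightarrow> real"
  assumes refl: "reflective h x y"
    and cont: "continuous_on UNIV h" "continuous_on UNIV x" "continuous_on UNIV y"
begin

lemma E_reflect:
  assumes "c\<^sup>2 + s\<^sup>2 = 1" and phi: "continuous_on UNIV (\<lambda>(u, v). phi u v)"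
  shows "E (\<lambda>S. h S * phi (c * x S + s * y S) (s * x S - c * y S)) = E (\<lambda>S. h S * phi (x S) (y S))"
proof -
  obtain R where R: "orthogonal_matrix R"
    "\<And>S. h (R ** S) = h S" "\<And>S. x (R ** S) = c * x S + s * y S" "\<And>S. y (R ** S) = s * x S - c * y S"
    using refl assms(1) unfolding reflective_def by blast
  have "continuous_on UNIV (\<lambda>S. case (x S, y S) of (u, v) \<Rightarrow> phi u v)"
    by (rule continuous_on_compose2[OF phi]) (auto intro!: continuous_intros cont)
  then have "continuous_on UNIV (\<lambda>S. h S * phi (x S) (y S))"
    by (intro continuous_intros cont) simp
  from E_left[OF this R(1)] show ?thesis by (simp add: R)
qed

text \<open>The reflection with \<open>c = 0\<close>, \<open>s = 1\<close> exchanges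
  \<open>x\<close> and \<open>y\<close>.\<close>

lemma E_reflect_swap: "E (\<lambda>S. h S * y S ^ q) = E (\<lambda>S. h S * x S ^ q)"
  using E_reflect[of 0 1 "\<lambda>u v. u ^ q"] by (simp add: case_prod_beta continuous_intros)

text \<open>The reflection with \<open>c = -1\<close>, \<open>s = 0\<close> negates \<open>x\<close>
  and fixes \<open>y\<close>, so the expectation equals its own negative.\<close>

lemma E_reflect_odd: "E (\<lambda>S. h S * (x S * y S ^ 2)) = 0"
  using E_reflect[of "-1" 0 "\<lambda>u v. u * v ^ 2"] by (simp add: case_prod_beta continuous_intros)

text \<open>Reflecting with \<open>(3/5, \<plusminus> 4/5)\<close> already suffices, and it keeps the arithmetic rational.\<close>

lemma E_reflect_4: "E (\<lambda>S. h S * x S ^ 4) = 3 * E (\<lambda>S. h S * (x S ^ 2 * y S ^ 2))"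
proof -
  have "2 * E (\<lambda>S. h S * x S ^ 4) = E (\<lambda>S. h S * (3/5 * x S + 4/5 * y S) ^ 4) + E (\<lambda>S. h S * (3/5 * x S + - 4/5 * y S) ^ 4)"
    using E_reflect[of "3/5" "4/5" "\<lambda>u v. u ^ 4"] E_reflect[of "3/5" "-4/5" "\<lambda>u v. u ^ 4"]
    by (simp add: case_prod_beta continuous_intros power2_eq_square)
  \<comment> \<open>Adding both signs cancels the odd powers. As \<open>x ^ 4\<close> and
    \<open>y ^ 4\<close> have equal weighted expectations, 1250 - 162 - 512 = 576 copies of the left
    moment equal 1728 copies of the mixed one, which is the ratio 3.\<close>
  also have "\<dots> = E (\<lambda>S. h S * (3/5 * x S + 4/5 * y S) ^ 4 + h S * (3/5 * x S + - 4/5 * y S) ^ 4)"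
    by (rule Bochner_Integration.integral_add[symmetric]) (intro integrable_H continuous_intros cont)+
  also have "(\<lambda>S. h S * (3/5 * x S + 4/5 * y S) ^ 4 + h S * (3/5 * x S + - 4/5 * y S) ^ 4) =
    (\<lambda>S. 162/625 * (h S * x S ^ 4) + 1728/625 * (h S * (x S ^ 2 * y S ^ 2)) + 512/625 * (h S * y S ^ 4))"
    by (rule ext) (simp add: power4_eq_xxxx power2_eq_square field_simps)
  also have "E \<dots> = 162/625 * E (\<lambda>S. h S * x S ^ 4) + 1728/625 * E (\<lambda>S. h S * (x S ^ 2 * y S ^ 2))
     + 512/625 * E (\<lambda>S. h S * y S ^ 4)"
    by (simp add: integrable_H continuous_intros cont)
  finally show ?thesis by (simp add: E_reflect_swap)
qed

end

end

text \<open>Moments of the squared coordinates of a uniform random unit vector. In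
  \<open>mom_double\<close> the list \<open>xs\<close> is the factor that does not involve the two
  rotated coordinates.\<close>

locale sphere_moments = exchangeable_moments mom 1 for mom :: "'i::finite list \<Rightarrow> real" +
  assumes mom_double: "\<And>i j xs. distinct [i,j] \<Longrightarrow> i \<notin> set xs \<Longrightarrow> j \<notin> set xs \<Longrightarrow>
    mom (i # i # xs) = 3 * mom (i # j # xs)"
begin

text \<open>Here and in the next two lemmas the multiples are products of 1, 3, 15, 105, the even
  moments of a standard Gaussian, and the denominators are the moments of the squared norm of an
  N-dimensional Gaussian vector: its direction is uniform and independent of its norm.\<close>

lemma moments_2:
  assumes "distinct [a,b]" and N: "N = real CARD('i)"
  shows "mom [a,b] = 1 / (N * (N + 2))" "mom [a,a] = 3 * mom [a,b]" "N > 0"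
proof -
  show N0: "N > 0" by (simp add: N)
  show m: "mom [a,a] = 3 * mom [a,b]" using mom_double[of a b "[]"] assms by simp
  have "N * ((N + 2) * mom [a,b]) = 1"
    using N_mom_1[of a] sum_mom_1[OF assms(1)] m by (simp add: N algebra_simps)
  moreover have "N * (N + 2) \<noteq> 0" using N0 by simp
  ultimately show "mom [a,b] = 1 / (N * (N + 2))" by (simp add: eq_divide_eq mult_ac)
qed

lemma moments_3:
  assumes d: "distinct [a,b,c]" and N: "N = real CARD('i)"
  shows "mom [a,b,c] = 1 / (N * (N + 2) * (N + 4))" "mom [a,a,b] = 3 * mom [a,b,c]"
    "mom [a,a,a] = 15 * mom [a,b,c]" 
proof -
  have d2: "distinct [a,b]" using d by simp
  have "mom [a,a,b] = mom [a,a,c]" by (rule mom_21) (use d in auto)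
  also have "\<dots> = 3 * mom [a,b,c]" using mom_double[of a b "[c]"] d by simp
  finally show m21: "mom [a,a,b] = 3 * mom [a,b,c]" .
  have m11: "mom [a,b] = (N + 4) * mom [a,b,c]"
    using sum_mom_11[OF d] m21 by (simp add: N algebra_simps)
  \<comment> \<open>\<open>mom_double\<close> does not apply when an index occurs more than twice;
    the sum rule gives this moment from the others.\<close>
  show "mom [a,a,a] = 15 * mom [a,b,c]"
    using sum_mom_2[OF d2] m21 m11 moments_2(2)[OF d2 N] by (simp add: N algebra_simps)
  show "mom [a,b,c] = 1 / (N * (N + 2) * (N + 4))"
  proof -
    have "N + 4 \<noteq> 0" using moments_2(3)[OF d2 N] by simp
    moreover have "mom [a,b,c] * (N + 4) = 1 / (N * (N + 2))"
      using m11 moments_2(1)[OF d2 N] by (simp add: mult.commute)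
    ultimately have "mom [a,b,c] = 1 / (N * (N + 2)) / (N + 4)"
      using nonzero_eq_divide_eq[of "N + 4"] by blast
    then show ?thesis by simp
  qed
qed

lemma moments_4:
  assumes d: "distinct [a,b,c,d]" and N: "N = real CARD('i)"
  shows "mom [a,b,c,d] = 1 / (N * (N + 2) * (N + 4) * (N + 6))" "mom [a,a,b,c] = 3 * mom [a,b,c,d]"
    "mom [a,a,b,b] = 9 * mom [a,b,c,d]" "mom [a,a,a,b] = 15 * mom [a,b,c,d]" "mom [a,a,a,a] = 105 * mom [a,b,c,d]"
proof -
  have d2: "distinct [a,b]" and d3: "distinct [a,b,c]" using d by simp_all
  have "mom [a,a,b,c] = mom [a,a,c,d]" by (rule mom_211) (use d in auto)
  also have "\<dots> = 3 * mom [a,b,c,d]" using mom_double[of a b "[c,d]"] d by simp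
  finally show m211: "mom [a,a,b,c] = 3 * mom [a,b,c,d]" .
  have "mom [a,a,b,b] = 3 * mom [a,c,b,b]" using mom_double[of a c "[b,b]"] d by auto
  also have "mom [a,c,b,b] = mom [b,b,a,c]" by (rule mom_mset) (simp add: add_mset_commute)
  also have "mom [b,b,a,c] = mom [a,a,b,c]" by (rule mom_211) (use d in auto)
  finally show m22: "mom [a,a,b,b] = 9 * mom [a,b,c,d]" using m211 by simp
  have m111: "mom [a,b,c] = (N + 6) * mom [a,b,c,d]"
    using sum_mom_111[OF d] m211 by (simp add: N algebra_simps)
  show m31: "mom [a,a,a,b] = 15 * mom [a,b,c,d]"
    using sum_mom_21[OF d3] m22 m211 m111 moments_3(2)[OF d3 N] by (simp add: N algebra_simps)
  show "mom [a,a,a,a] = 105 * mom [a,b,c,d]"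
    using sum_mom_3[OF d2] m31 m111 moments_3(3)[OF d3 N] by (simp add: N algebra_simps)
  show "mom [a,b,c,d] = 1 / (N * (N + 2) * (N + 4) * (N + 6))"
  proof -
    have "N + 6 \<noteq> 0" using moments_2(3)[OF d2 N] by simp
    moreover have "mom [a,b,c,d] * (N + 6) = 1 / (N * (N + 2) * (N + 4))"
      using m111 moments_3(1)[OF d3 N] by (simp add: mult.commute)
    ultimately have "mom [a,b,c,d] = 1 / (N * (N + 2) * (N + 4)) / (N + 6)"
      using nonzero_eq_divide_eq[of "N + 6"] by blast
    then show ?thesis by simp
  qed
qed

end

text \<open>With \<open>total = 0\<close> the sum rules become homogeneous and express the mixed
  moments through the pure ones, up to one free moment in degree 4.\<close>

locale centered_moments = exchangeable_moments mom 0 for mom :: "'i::finite list \<Rightarrow> real"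
begin

lemma quadratic_form_centered:
  assumes w: "(\<Sum>i\<in>UNIV. w i) = 0" and d: "distinct [a,b]" and N: "N = real CARD('i)" "N > 1"
  shows "(\<Sum>i\<in>UNIV. \<Sum>j\<in>UNIV. w i * w j * mom [i,j]) = N / (N - 1) * mom [a,a] * psum w 2"
proof -
  have "mom [a,b] = - mom [a,a] / (N - 1)"
    using sum_mom_1[OF d] N by (simp add: field_simps)
  then have "mom [a,a] - mom [a,b] = N / (N - 1) * mom [a,a]"
    using N(2) by (simp add: field_simps)
  then show ?thesis unfolding quadratic_form[OF w d] by simp
qed

lemma cubic_form_centered:
  assumes w: "(\<Sum>i\<in>UNIV. w i) = 0" and d: "distinct [a,b,c]" and N: "N = real CARD('i)" "N > 2"
  shows "(\<Sum>i\<in>UNIV. \<Sum>j\<in>UNIV. \<Sum>k\<in>UNIV. w i * w j * w k * mom [i,j,k]) =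
    N^2 / ((N - 1) * (N - 2)) * mom [a,a,a] * psum w 3"
proof -
  have d2: "distinct [a,b]" using d by simp
  have 1: "mom [a,a,b] = - mom [a,a,a] / (N - 1)"
    using sum_mom_2[OF d2] N by (simp add: field_simps)
  have 2: "mom [a,b,c] = - 2 * mom [a,a,b] / (N - 2)"
    using sum_mom_11[OF d] N by (simp add: field_simps)
  have "mom [a,a,a] - 3 * mom [a,a,b] + 2 * mom [a,b,c] = N^2 / ((N - 1) * (N - 2)) * mom [a,a,a]"
    unfolding 2 1 using N(2) by (simp add: divide_simps) (simp add: algebra_simps power2_eq_square)
  then show ?thesis unfolding cubic_form[OF w d] by simp
qed

text \<open>\<open>K\<close> stands for \<open>psum b 2\<close> times the second moment, and its
  hypothesis is the relation obtained from the trace of the squared matrix: it supplies the equation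
  for \<open>mom [a,a,b,b]\<close> that the sum rules lack. The conclusion is multiplied out so that
  the final identities are polynomial.\<close>

lemma quartic_form_centered:
  assumes w: "(\<Sum>i\<in>UNIV. w i) = 0" and d: "distinct [a,b,c,d]" and N: "N = real CARD('i)" "N > 3"
    and M: "M = mom [a,a,a,a]"
    and K: "M + (N - 1) * mom [a,a,b,b]
      + 2 * (N - 1) * ((M - mom [a,a,b,b]) / 8 + (2 * M - 8 * mom [a,a,a,b] + 6 * mom [a,a,b,b]) / 48)
      + (N - 1) * (N - 2) * ((mom [a,a,b,b] - mom [a,a,b,c]) / 2) = K"
  shows "(N + 1) * (N - 1) * (N - 2) * (N - 3) *
    (\<Sum>i\<in>UNIV. \<Sum>j\<in>UNIV. \<Sum>k\<in>UNIV. \<Sum>l\<in>UNIV. w i * w j * w k * w l * mom [i,j,k,l]) =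
    (N^2 * (N^2 + N + 2) * M - 6 * N * (N - 1) * K) * psum w 4
    + (6 * (N^2 - 3 * N + 3) * K - N * (2 * N^2 + 3 * N - 6) * M) * (psum w 2)^2"
proof -
  have d2: "distinct [a,b]" and d3: "distinct [a,b,c]" using d by simp_all
  define Z where "Z = mom [a,a,b,b]"
  define Y where "Y = mom [a,a,b,c]"
  have 1: "mom [a,a,a,b] = - M / (N - 1)"
    using sum_mom_3[OF d2] N by (simp add: M field_simps)
  have "(N - 2) * Y = M / (N - 1) - Z"
    using sum_mom_21[OF d3] 1 N by (simp add: Z_def Y_def)
  then have 2: "(N - 1) * ((N - 2) * Y) = M - (N - 1) * Z"
    using N(2) by (simp add: field_simps)
  have 3: "(N - 3) * mom [a,b,c,d] = - 3 * Y"
    using sum_mom_111[OF d] N by (simp add: Y_def)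
  \<comment> \<open>Once the 31 moment is expressed by \<open>M\<close>, the terms in
    \<open>Z\<close> cancel: the off-diagonal entries in row and column \<open>a\<close> contribute
    only a multiple of \<open>M\<close>.\<close>
  have "2 * (N - 1) * ((M - Z) / 8 + (2 * M - 8 * (- M / (N - 1)) + 6 * Z) / 48) = N * M / 3"
    using N(2) by (simp add: field_simps)
  then have "M + (N - 1) * Z + N * M / 3 + (N - 1) * (N - 2) * ((Z - Y) / 2) = K"
    using K unfolding Z_def[symmetric] Y_def[symmetric] 1 by simp
  moreover have "(N - 1) * (N - 2) * ((Z - Y) / 2) = (N - 1) * (N - 2) * Z / 2 - (M - (N - 1) * Z) / 2"
    unfolding 2[symmetric] by (simp add: field_simps)
  ultimately have "M + (N - 1) * Z + N * M / 3 + (N - 1) * (N - 2) * Z / 2 - (M - (N - 1) * Z) / 2 = K"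
    by (simp only: add_diff_eq)
  then have 4: "3 * (N - 1) * (N + 1) * Z = 6 * K - (2 * N + 3) * M"
    by (simp add: field_simps)
  define X where "X = mom [a,b,c,d]"
  define W where "W = mom [a,a,a,b]"
  \<comment> \<open>A common denominator: \<open>D\<close> times each mixed moment is a polynomial
    in \<open>N\<close>, linear in \<open>M\<close> and \<open>K\<close> (up to a factor 3).\<close>
  define D where "D = (N + 1) * (N - 1) * (N - 2) * (N - 3)"
  have W: "D * W = - ((N + 1) * (N - 2) * (N - 3) * M)"
    using N(2) by (simp add: D_def W_def 1)
  have Z: "3 * (D * Z) = (N - 2) * (N - 3) * (6 * K - (2 * N + 3) * M)"
    unfolding 4[symmetric] D_def by simp
  have Y: "3 * (D * Y) = (N - 3) * ((5 * N + 6) * M - 6 * K)"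
  proof -
    have "3 * (D * Y) = 3 * (N + 1) * (N - 3) * ((N - 1) * ((N - 2) * Y))"
      by (simp add: D_def)
    also have "\<dots> = (N - 3) * (3 * (N + 1) * M - 3 * (N - 1) * (N + 1) * Z)"
      unfolding 2 by (simp add: algebra_simps)
    finally show ?thesis unfolding 4 by (simp add: algebra_simps)
  qed
  have X: "D * X = - ((5 * N + 6) * M - 6 * K)"
  proof -
    have "(N - 3) * (D * X) = D * ((N - 3) * X)"
      by simp
    also have "\<dots> = - (3 * (D * Y))"
      unfolding X_def 3 by simp
    finally have "(N - 3) * (D * X) = (N - 3) * (- ((5 * N + 6) * M - 6 * K))"
      unfolding Y by (simp only: mult_minus_right)
    then show ?thesis using N(2) by simp
  qed
  have "D * (M - 4 * W - 3 * Z + 12 * Y - 6 * X) = D * M - 4 * (D * W) - 3 * (D * Z) + 4 * (3 * (D * Y)) - 6 * (D * X)"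
    by (simp add: algebra_simps)
  also have "\<dots> = N^2 * (N^2 + N + 2) * M - 6 * N * (N - 1) * K"
    unfolding W Z Y X unfolding D_def by algebra
  finally have c4: "D * (M - 4 * W - 3 * Z + 12 * Y - 6 * X) = \<dots>" .
  have "D * (3 * (Z - 2 * Y + X)) = 3 * (D * Z) - 2 * (3 * (D * Y)) + 3 * (D * X)"
    by (simp add: algebra_simps)
  also have "\<dots> = 6 * (N^2 - 3 * N + 3) * K - N * (2 * N^2 + 3 * N - 6) * M"
    unfolding Z Y X by algebra
  finally have c22: "D * (3 * (Z - 2 * Y + X)) = \<dots>" .
  show ?thesis
    unfolding quartic_form[OF w d] c4[symmetric] c22[symmetric]
    by (simp add: M W_def X_def Y_def Z_def D_def algebra_simps)
qed

end

section \<open>Diagonal entries of a conjugated diagonal matrix\<close>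

text \<open>Supplies the distinct indices at which the moments are evaluated; the lower bounds on
  \<open>n\<close> guarantee enough of them.\<close>

lemma ex_distinct_list:
  assumes "k \<le> CARD('i::finite)"
  shows "\<exists>xs :: 'i list. distinct xs \<and> length xs = k"
proof -
  obtain ys :: "'i list" where ys: "set ys = UNIV" "distinct ys"
    using finite_distinct_list[of "UNIV :: 'i set"] by auto
  then have "length ys = CARD('i)" using distinct_card by metis
  then show ?thesis using ys assms by (intro exI[of _ "take k ys"]) simp
qed

lemma ex_distinct_2: "2 \<le> CARD('i::finite) \<Longrightarrow> \<exists>i j :: 'i. distinct [i,j]"
  using ex_distinct_list[of 2, where 'i='i] by (fastforce simp: length_Suc_conv numeral_2_eq_2)

lemma ex_distinct_3: "3 \<le> CARD('i::finite) \<Longrightarrow> \<exists>i j k :: 'i. distinct [i,j,k]"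
  using ex_distinct_list[of 3, where 'i='i] by (fastforce simp: length_Suc_conv numeral_3_eq_3)

lemma ex_distinct_4: "4 \<le> CARD('i::finite) \<Longrightarrow> \<exists>i j k l :: 'i. distinct [i,j,k,l]"
  using ex_distinct_list[of 4, where 'i='i] by (fastforce simp: length_Suc_conv eval_nat_numeral)

lemma orthogonal_matrix_columns:
  assumes "orthogonal_matrix (S :: real^'m^'m)"
  shows "(\<Sum>i\<in>UNIV. S $ i $ j * S $ i $ k) = (if j = k then 1 else 0)"
proof -
  have "(transpose S ** S) $ j $ k = mat 1 $ j $ k"
    using assms by (simp add: orthogonal_matrix)
  then show ?thesis by (simp add: matrix_matrix_mult_def transpose_def mat_def)
qed

lemma orthogonal_matrix_sum_squares:
  assumes "orthogonal_matrix (S :: real^'m^'m)"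
  shows "(\<Sum>i\<in>UNIV. (\<Sum>j\<in>UNIV. v j * S $ i $ j) ^ 2) = (\<Sum>j\<in>UNIV. v j ^ 2)"
proof -
  have "orthogonal_transformation ((*v) S)"
    using assms by (simp add: orthogonal_transformation_matrix)
  then have "norm (S *v (\<chi> j. v j)) = norm (\<chi> j. v j)"
    by (rule orthogonal_transformation_norm)
  then have "(S *v (\<chi> j. v j)) \<bullet> (S *v (\<chi> j. v j)) = (\<chi> j. v j) \<bullet> (\<chi> j. v j)"
    by (simp add: norm_eq)
  then show ?thesis
    by (simp add: inner_vec_def matrix_vector_mult_def power2_eq_square mult.commute)
qed

text \<open>The \<open>(i, k)\<close> entry of \<open>S ** diag b ** transpose S\<close>.\<close>

definition conj_diag :: "('m \<Rightarrow> real) \<Rightarrow> 'm \<Rightarrow> 'm \<Rightarrow> real^'m^'m \<Rightarrow> real" where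
  "conj_diag b i k S = (\<Sum>j\<in>UNIV. b j * S $ i $ j * S $ k $ j)"

lemma continuous_on_conj_diag: "continuous_on A (conj_diag b i k)"
  unfolding conj_diag_def by (intro continuous_intros)

lemma sum_conj_diag:
  assumes "orthogonal_matrix S"
  shows "(\<Sum>i\<in>UNIV. conj_diag b i i S) = (\<Sum>j\<in>UNIV. b j)"
proof -
  have "(\<Sum>i\<in>UNIV. conj_diag b i i S) = (\<Sum>j\<in>UNIV. \<Sum>i\<in>UNIV. b j * (S $ i $ j * S $ i $ j))"
    unfolding conj_diag_def by (subst sum.swap) (simp add: mult_ac)
  then show ?thesis by (simp add: orthogonal_matrix_columns[OF assms] flip: sum_distrib_left)
qed

text \<open>The squared Frobenius norm. Row \<open>i\<close> of the conjugated matrix is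
  \<open>S\<close> applied to the vector with entries \<open>b j * S $ i $ j\<close>, and
  \<open>S\<close> preserves its norm.\<close>

lemma sum_conj_diag_squares:
  assumes "orthogonal_matrix S"
  shows "(\<Sum>i\<in>UNIV. \<Sum>k\<in>UNIV. conj_diag b i k S ^ 2) = psum b 2"
proof -
  have "(\<Sum>k\<in>UNIV. conj_diag b i k S ^ 2) = (\<Sum>j\<in>UNIV. (b j * S $ i $ j) ^ 2)" for i
    unfolding conj_diag_def using orthogonal_matrix_sum_squares[OF assms, of "\<lambda>j. b j * S $ i $ j"]
    by simp
  then have "(\<Sum>i\<in>UNIV. \<Sum>k\<in>UNIV. conj_diag b i k S ^ 2) = (\<Sum>j\<in>UNIV. \<Sum>i\<in>UNIV. b j ^ 2 * (S $ i $ j * S $ i $ j))"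
    by (subst sum.swap) (simp add: power2_eq_square mult_ac)
  then show ?thesis by (simp add: orthogonal_matrix_columns[OF assms] flip: sum_distrib_left)
qed

text \<open>Left multiplication acts on column \<open>a\<close> as on a vector, and the reflection
  touches only its coordinates \<open>i\<close> and \<open>k\<close>.\<close>

lemma reflective_column:
  fixes i k a :: "'m::finite"
  assumes "i \<noteq> k" "i \<notin> set xs" "k \<notin> set xs"
  shows "reflective (\<lambda>S. \<Prod>l\<leftarrow>xs. (S $ l $ a) ^ 2) (\<lambda>S. S $ i $ a) (\<lambda>S. S $ k $ a)"
  unfolding reflective_def
proof (intro allI impI exI conjI)
  fix c s :: real and S :: "real^'m^'m" assume cs: "c\<^sup>2 + s\<^sup>2 = 1"
  show "orthogonal_matrix (plane_reflection c s i k)"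
    by (rule orthogonal_plane_reflection[OF assms(1) cs])
  have "map (\<lambda>l. ((plane_reflection c s i k ** S) $ l $ a) ^ 2) xs = map (\<lambda>l. (S $ l $ a) ^ 2) xs"
    by (rule map_cong[OF refl]) (use assms in \<open>auto simp: plane_reflection_mult\<close>)
  then show "(\<Prod>l\<leftarrow>xs. ((plane_reflection c s i k ** S) $ l $ a) ^ 2) = (\<Prod>l\<leftarrow>xs. (S $ l $ a) ^ 2)"
    by (simp only:)
qed (use assms in \<open>auto simp: plane_reflection_mult\<close>)

text \<open>
  A rotation of two coordinates by an angle \<open>t\<close> fixes the sum of the two diagonal entries of the
  conjugated matrix and rotates their half difference and the off-diagonal entry by \<open>2 * t\<close>.
\<close>

lemma conj_diag_reflection:
  fixes i k :: "'m::finite"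
  assumes "i \<noteq> k" "c\<^sup>2 + s\<^sup>2 = 1"
  obtains R where "orthogonal_matrix R"
    "\<And>S. conj_diag b i i (R ** S) + conj_diag b k k (R ** S) = conj_diag b i i S + conj_diag b k k S"
    "\<And>S. (conj_diag b i i (R ** S) - conj_diag b k k (R ** S)) / 2 =
       c * ((conj_diag b i i S - conj_diag b k k S) / 2) + s * conj_diag b i k S"
    "\<And>S. conj_diag b i k (R ** S) =
       s * ((conj_diag b i i S - conj_diag b k k S) / 2) - c * conj_diag b i k S"
    "\<And>S a. a \<notin> {i,k} \<Longrightarrow> conj_diag b a a (R ** S) = conj_diag b a a S"
proof -
  obtain t where t: "c = cos t" "s = sin t"
    using sincos_total_2pi[OF assms(2)] by metis
  \<comment> \<open>Conjugation doubles the angle, so the prescribed \<open>c\<close> and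
    \<open>s\<close> need a reflection with half the angle.\<close>
  define u v where "u = cos (t / 2)" and "v = sin (t / 2)"
  have uv: "u\<^sup>2 + v\<^sup>2 = 1" by (simp add: u_def v_def)
  have c: "c = u\<^sup>2 - v\<^sup>2" and s: "s = 2 * v * u"
    using cos_double[of "t / 2"] sin_double[of "t / 2"] by (simp_all add: t u_def v_def)
  define R where "R = (plane_reflection u v i k :: real^'m^'m)"
  have ii: "conj_diag b i i (R ** S) = u\<^sup>2 * conj_diag b i i S + 2 * u * v * conj_diag b i k S + v\<^sup>2 * conj_diag b k k S" for S
    unfolding conj_diag_def R_def using assms(1)
    by (simp add: plane_reflection_mult sum_distrib_left power2_eq_square algebra_simps flip: sum.distrib sum_subtractf)
  have kk: "conj_diag b k k (R ** S) = v\<^sup>2 * conj_diag b i i S - 2 * u * v * conj_diag b i k S + u\<^sup>2 * conj_diag b k k S" for S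
    unfolding conj_diag_def R_def using assms(1)
    by (simp add: plane_reflection_mult sum_distrib_left power2_eq_square algebra_simps flip: sum.distrib sum_subtractf)
  have ik: "conj_diag b i k (R ** S) = u * v * conj_diag b i i S - (u\<^sup>2 - v\<^sup>2) * conj_diag b i k S - u * v * conj_diag b k k S" for S
    unfolding conj_diag_def R_def using assms(1)
    by (simp add: plane_reflection_mult sum_distrib_left power2_eq_square algebra_simps flip: sum.distrib sum_subtractf)
  show ?thesis
  proof (rule that)
    show "orthogonal_matrix R"
      unfolding R_def by (rule orthogonal_plane_reflection[OF assms(1) uv])
    show "conj_diag b i i (R ** S) + conj_diag b k k (R ** S) = conj_diag b i i S + conj_diag b k k S" for S
    proof -
      have "conj_diag b i i (R ** S) + conj_diag b k k (R ** S) = (u\<^sup>2 + v\<^sup>2) * (conj_diag b i i S + conj_diag b k k S)"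
        unfolding ii kk by (simp add: algebra_simps)
      then show ?thesis by (simp add: uv)
    qed
    show "(conj_diag b i i (R ** S) - conj_diag b k k (R ** S)) / 2 =
       c * ((conj_diag b i i S - conj_diag b k k S) / 2) + s * conj_diag b i k S" for S
      unfolding ii kk c s by (simp add: field_simps)
    show "conj_diag b i k (R ** S) =
       s * ((conj_diag b i i S - conj_diag b k k S) / 2) - c * conj_diag b i k S" for S
      unfolding ik c s by (simp add: field_simps)
    show "conj_diag b a a (R ** S) = conj_diag b a a S" if "a \<notin> {i,k}" for S a
      using that assms(1) by (simp add: conj_diag_def R_def plane_reflection_mult)
  qed
qed

text \<open>\<open>g\<close> is left free because the invariant factors 1, \<open>u\<close> and
  \<open>u ^ 2\<close> are all needed, where \<open>u\<close> is the sum of the two diagonal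
  entries.\<close>

lemma reflective_conj_diag:
  assumes "i \<noteq> k"
  shows "reflective (\<lambda>S. g (conj_diag b i i S + conj_diag b k k S))
    (\<lambda>S. (conj_diag b i i S - conj_diag b k k S) / 2) (conj_diag b i k)"
  unfolding reflective_def
proof (intro allI impI)
  fix c s :: real assume "c\<^sup>2 + s\<^sup>2 = 1"
  from conj_diag_reflection[OF assms this, of b] show "\<exists>R. orthogonal_matrix R \<and>
     (\<forall>S. g (conj_diag b i i (R ** S) + conj_diag b k k (R ** S)) = g (conj_diag b i i S + conj_diag b k k S) \<and>
      (conj_diag b i i (R ** S) - conj_diag b k k (R ** S)) / 2 =
       c * ((conj_diag b i i S - conj_diag b k k S) / 2) + s * conj_diag b i k S \<and>
      conj_diag b i k (R ** S) = s * ((conj_diag b i i S - conj_diag b k k S) / 2) - c * conj_diag b i k S)"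
    by metis
qed

lemma reflective_conj_diag_other:
  assumes "i \<noteq> k" "a \<notin> {i,k}"
  shows "reflective (\<lambda>S. g (conj_diag b a a S))
    (\<lambda>S. (conj_diag b i i S - conj_diag b k k S) / 2) (conj_diag b i k)"
  unfolding reflective_def
proof (intro allI impI)
  fix c s :: real assume "c\<^sup>2 + s\<^sup>2 = 1"
  from conj_diag_reflection[OF assms(1) this, of b] show "\<exists>R. orthogonal_matrix R \<and>
     (\<forall>S. g (conj_diag b a a (R ** S)) = g (conj_diag b a a S) \<and>
      (conj_diag b i i (R ** S) - conj_diag b k k (R ** S)) / 2 =
       c * ((conj_diag b i i S - conj_diag b k k S) / 2) + s * conj_diag b i k S \<and>
      conj_diag b i k (R ** S) = s * ((conj_diag b i i S - conj_diag b k k S) / 2) - c * conj_diag b i k S)"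
    using assms(2) by metis
qed

section \<open>Moments of a single diagonal entry\<close>

context haar
begin

lemma sphere_moments_column:
  "sphere_moments (\<lambda>is. E (\<lambda>S. \<Prod>i\<leftarrow>is. (S $ i $ a) ^ 2))"
proof -
  interpret exchangeable_moments "\<lambda>is. E (\<lambda>S. \<Prod>i\<leftarrow>is. (S $ i $ a) ^ 2)" 1
    by (rule exchangeable_moments_E)
      (auto intro!: continuous_intros simp: permutation_matrix_mult orthogonal_matrix_columns power2_eq_square)
  show ?thesis
  proof
    fix i j and xs :: "'m list"
    assume d: "distinct [i,j]" "i \<notin> set xs" "j \<notin> set xs"
    have "E (\<lambda>S. (\<Prod>l\<leftarrow>xs. (S $ l $ a) ^ 2) * S $ i $ a ^ 4) =
      3 * E (\<lambda>S. (\<Prod>l\<leftarrow>xs. (S $ l $ a) ^ 2) * (S $ i $ a ^ 2 * S $ j $ a ^ 2))"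
      by (rule E_reflect_4[OF reflective_column])
        (use d in \<open>auto intro!: continuous_intros continuous_on_prod_list\<close>)
    then show "E (\<lambda>S. \<Prod>i\<leftarrow>i # i # xs. (S $ i $ a) ^ 2) = 3 * E (\<lambda>S. \<Prod>i\<leftarrow>i # j # xs. (S $ i $ a) ^ 2)"
      by (simp add: mult_ac power4_eq_xxxx power2_eq_square)
  qed
qed

text \<open>Passes from row \<open>a\<close> to column \<open>a\<close>, whose moments are known
  from \<open>sphere_moments_column\<close>.\<close>

lemma E_conj_diag_power:
  "E (\<lambda>S. conj_diag b a a S ^ q) = E (\<lambda>S. (\<Sum>i\<in>UNIV. b i * (S $ i $ a) ^ 2) ^ q)"
proof -
  have "E (\<lambda>S. conj_diag b a a S ^ q) = E (\<lambda>S. conj_diag b a a (transpose S) ^ q)"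
    by (rule E_transpose[symmetric]) (intro continuous_intros continuous_on_conj_diag)
  then show ?thesis by (simp add: conj_diag_def transpose_def power2_eq_square mult.assoc)
qed

text \<open>The numerators in degrees 2, 3 and 4 are the moments of \<open>sum b_i * g_i ^ 2\<close>
  for independent standard Gaussians \<open>g_i\<close>, whose cumulants are
  \<open>2^(r-1) (r-1)!\<close> times \<open>psum b r\<close>; in degree 4 this is 48 for
  \<open>psum b 4\<close> and 3 times the square of 2 for \<open>(psum b 2)^2\<close>.\<close>

lemma E_conj_diag_2:
  assumes b: "(\<Sum>j\<in>UNIV. b j) = 0" and N: "N = real CARD('m)" "N > 1"
  shows "E (\<lambda>S. conj_diag b a a S ^ 2) = 2 * psum b 2 / (N * (N + 2))"
proof -
  interpret sphere_moments "\<lambda>is. E (\<lambda>S. \<Prod>i\<leftarrow>is. (S $ i $ a) ^ 2)"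
    by (rule sphere_moments_column)
  obtain i j :: 'm where d: "distinct [i,j]"
    using N ex_distinct_2[where 'i='m] by auto
  have "E (\<lambda>S. conj_diag b a a S ^ 2) = (3 * (1 / (N * (N + 2))) - 1 / (N * (N + 2))) * psum b 2"
    unfolding E_conj_diag_power
    by (subst E_sum_power2, intro continuous_intros)
      (simp only: quadratic_form[OF b d] moments_2(1,2)[OF d N(1)])
  then show ?thesis by simp
qed

lemma E_conj_diag_3:
  assumes b: "(\<Sum>j\<in>UNIV. b j) = 0" and N: "N = real CARD('m)" "N > 2"
  shows "E (\<lambda>S. conj_diag b a a S ^ 3) = 8 * psum b 3 / (N * (N + 2) * (N + 4))"
proof -
  interpret sphere_moments "\<lambda>is. E (\<lambda>S. \<Prod>i\<leftarrow>is. (S $ i $ a) ^ 2)"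
    by (rule sphere_moments_column)
  obtain i j k :: 'm where d: "distinct [i,j,k]"
    using N ex_distinct_3[where 'i='m] by auto
  have "E (\<lambda>S. conj_diag b a a S ^ 3) = (15 * (1 / (N * (N + 2) * (N + 4)))
      - 3 * (3 * (1 / (N * (N + 2) * (N + 4)))) + 2 * (1 / (N * (N + 2) * (N + 4)))) * psum b 3"
    unfolding E_conj_diag_power
    by (subst E_sum_power3, intro continuous_intros)
      (simp only: cubic_form[OF b d] moments_3[OF d N(1)])
  then show ?thesis by simp
qed

lemma E_conj_diag_4:
  assumes b: "(\<Sum>j\<in>UNIV. b j) = 0" and N: "N = real CARD('m)" "N > 3"
  shows "E (\<lambda>S. conj_diag b a a S ^ 4) =
    (48 * psum b 4 + 12 * (psum b 2)^2) / (N * (N + 2) * (N + 4) * (N + 6))"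
proof -
  interpret sphere_moments "\<lambda>is. E (\<lambda>S. \<Prod>i\<leftarrow>is. (S $ i $ a) ^ 2)"
    by (rule sphere_moments_column)
  obtain i j k l :: 'm where d: "distinct [i,j,k,l]"
    using N ex_distinct_4[where 'i='m] by auto
  define c where "c = 1 / (N * (N + 2) * (N + 4) * (N + 6))"
  have "E (\<lambda>S. conj_diag b a a S ^ 4) =
     (105 * c - 4 * (15 * c) - 3 * (9 * c) + 12 * (3 * c) - 6 * c) * psum b 4
      + 3 * (9 * c - 2 * (3 * c) + c) * (psum b 2)^2"
    unfolding E_conj_diag_power
    by (subst E_sum_power4, intro continuous_intros)
      (simp only: quartic_form[OF b d] moments_4[OF d N(1)] c_def)
  then show ?thesis by (simp add: c_def add_divide_distrib mult.assoc)
qed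

lemma exchangeable_moments_conj_diag:
  "exchangeable_moments (\<lambda>is. E (\<lambda>S. \<Prod>i\<leftarrow>is. conj_diag b i i S)) (psum b 1)"
proof (rule exchangeable_moments_E)
  show "conj_diag b i i (permutation_matrix p ** S) = conj_diag b (p i) (p i) S" for p i S
    by (simp add: conj_diag_def permutation_matrix_mult)
qed (simp_all add: continuous_on_conj_diag sum_conj_diag)

lemma centered_moments_conj_diag:
  assumes b: "(\<Sum>j\<in>UNIV. b j) = 0"
  shows "centered_moments (\<lambda>is. E (\<lambda>S. \<Prod>i\<leftarrow>is. conj_diag b i i S))"
  using exchangeable_moments_conj_diag[of b] by (simp add: centered_moments_def b)

section \<open>The relation from the trace of the squared conjugated matrix\<close>

context
  fixes b :: "'m \<Rightarrow> real"
  assumes b: "(\<Sum>j\<in>UNIV. b j) = 0"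
begin

abbreviation q :: "'m \<Rightarrow> real^'m^'m \<Rightarrow> real" where
  "q i \<equiv> conj_diag b i i"

abbreviation mom :: "'m list \<Rightarrow> real" where
  "mom xs \<equiv> E (\<lambda>S. \<Prod>i\<leftarrow>xs. q i S)"

interpretation centered_moments mom
  by (rule centered_moments_conj_diag[OF b])

text \<open>A reflection in coordinates \<open>i\<close> and \<open>k\<close> fixes
  \<open>q a\<close> and can exchange the off-diagonal entry with
  \<open>(q i - q k) / 2\<close>.\<close>

lemma E_diag_offdiag_disjoint:
  assumes d: "distinct [a,i,k]"
  shows "E (\<lambda>S. q a S ^ 2 * conj_diag b i k S ^ 2) = (mom [a,a,i,i] - mom [a,a,i,k]) / 2"
proof -
  have "E (\<lambda>S. q a S ^ 2 * conj_diag b i k S ^ 2) = E (\<lambda>S. q a S ^ 2 * ((q i S - q k S) / 2) ^ 2)"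
    by (rule E_reflect_swap[OF reflective_conj_diag_other])
      (use d in \<open>auto intro!: continuous_intros continuous_on_conj_diag\<close>)
  also have "(\<lambda>S. q a S ^ 2 * ((q i S - q k S) / 2) ^ 2) = (\<lambda>S. 1/4 * (\<Prod>i\<leftarrow>[a,a,i,i]. q i S)
      + 1/4 * (\<Prod>i\<leftarrow>[a,a,k,k]. q i S) - 1/2 * (\<Prod>i\<leftarrow>[a,a,i,k]. q i S))"
    by (rule ext) (simp add: power2_eq_square field_simps)
  also have "E \<dots> = 1/4 * mom [a,a,i,i] + 1/4 * mom [a,a,k,k] - 1/2 * mom [a,a,i,k]"
    by (simp add: integrable_H continuous_intros continuous_on_conj_diag)
  also have "mom [a,a,k,k] = mom [a,a,i,i]"
    by (rule mom_22) (use d in auto)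
  finally show ?thesis by simp
qed

text \<open>Here \<open>q a\<close> moves as well, so it is split as \<open>u / 2 + v\<close> with
  \<open>u\<close> fixed and the pair \<open>(v, r)\<close> rotated. The three terms of
  \<open>q a ^ 2 * r ^ 2\<close> are settled by exchanging \<open>v\<close> and \<open>r\<close>, by
  oddness in \<open>v\<close>, and by the factor 3; 48 is 3 times the 16 from halving in
  \<open>v ^ 4\<close>.\<close>

lemma E_diag_offdiag_common:
  assumes d: "distinct [a,k]"
  shows "E (\<lambda>S. q a S ^ 2 * conj_diag b a k S ^ 2) =
    (mom [a,a,a,a] - mom [a,a,k,k]) / 8 + (2 * mom [a,a,a,a] - 8 * mom [a,a,a,k] + 6 * mom [a,a,k,k]) / 48"
proof -
  define u where "u = (\<lambda>S. q a S + q k S)"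
  define v where "v = (\<lambda>S. (q a S - q k S) / 2)"
  define r where "r = conj_diag b a k"
  have refl: "reflective (\<lambda>S. g (u S)) v r" for g
    unfolding u_def v_def r_def using d by (intro reflective_conj_diag) simp
  have cont: "continuous_on UNIV u" "continuous_on UNIV v" "continuous_on UNIV r"
    unfolding u_def v_def r_def by (auto intro!: continuous_intros continuous_on_conj_diag)
  have comm: "mom [a,k,k,k] = mom [a,a,a,k]" "mom [k,k,k,k] = mom [a,a,a,a]"
  proof -
    have "mom [a,k,k,k] = mom [k,k,k,a]" by (rule mom_mset) (simp add: add_mset_commute)
    also have "\<dots> = mom [a,a,a,k]" by (rule mom_31) (use d in auto)
    finally show "mom [a,k,k,k] = mom [a,a,a,k]" .
  qed (rule mom_4)
  have 1: "E (\<lambda>S. u S ^ 2 * r S ^ 2) = E (\<lambda>S. u S ^ 2 * v S ^ 2)"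
    by (rule E_reflect_swap[OF refl]) (intro continuous_intros cont)+
  have 2: "E (\<lambda>S. u S * (v S * r S ^ 2)) = 0"
    by (rule E_reflect_odd[OF refl]) (intro continuous_intros cont)+
  have 3: "E (\<lambda>S. 1 * v S ^ 4) = 3 * E (\<lambda>S. 1 * (v S ^ 2 * r S ^ 2))"
    by (rule E_reflect_4[OF refl]) (intro continuous_intros cont)+
  have "(\<lambda>S. q a S ^ 2 * r S ^ 2) = (\<lambda>S. 1/4 * (u S ^ 2 * r S ^ 2) + u S * (v S * r S ^ 2) + 1 * (v S ^ 2 * r S ^ 2))"
    by (rule ext) (simp add: u_def v_def power2_eq_square field_simps)
  then have "E (\<lambda>S. q a S ^ 2 * r S ^ 2) = 1/4 * E (\<lambda>S. u S ^ 2 * r S ^ 2) + E (\<lambda>S. u S * (v S * r S ^ 2)) + E (\<lambda>S. 1 * (v S ^ 2 * r S ^ 2))"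
    by (simp add: integrable_H continuous_intros cont)
  also have "\<dots> = 1/4 * E (\<lambda>S. u S ^ 2 * v S ^ 2) + 1/3 * E (\<lambda>S. 1 * v S ^ 4)"
    unfolding 1 2 3 by simp
  also have "(\<lambda>S. u S ^ 2 * v S ^ 2) = (\<lambda>S. 1/4 * (\<Prod>i\<leftarrow>[a,a,a,a]. q i S)
      + 1/4 * (\<Prod>i\<leftarrow>[k,k,k,k]. q i S) - 1/2 * (\<Prod>i\<leftarrow>[a,a,k,k]. q i S))"
    by (rule ext) (simp add: u_def v_def power2_eq_square field_simps)
  also have "E \<dots> = 1/4 * mom [a,a,a,a] + 1/4 * mom [k,k,k,k] - 1/2 * mom [a,a,k,k]"
    by (simp add: integrable_H continuous_intros continuous_on_conj_diag)
  also have "(\<lambda>S. 1 * v S ^ 4) = (\<lambda>S. 1/16 * (\<Prod>i\<leftarrow>[a,a,a,a]. q i S)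
      + 1/16 * (\<Prod>i\<leftarrow>[k,k,k,k]. q i S) + 3/8 * (\<Prod>i\<leftarrow>[a,a,k,k]. q i S)
      - 1/4 * (\<Prod>i\<leftarrow>[a,a,a,k]. q i S) - 1/4 * (\<Prod>i\<leftarrow>[a,k,k,k]. q i S))"
    by (rule ext) (simp add: v_def power4_eq_xxxx field_simps)
  also have "E \<dots> = 1/16 * mom [a,a,a,a] + 1/16 * mom [k,k,k,k] + 3/8 * mom [a,a,k,k]
     - 1/4 * mom [a,a,a,k] - 1/4 * mom [a,k,k,k]"
    by (simp add: integrable_H continuous_intros continuous_on_conj_diag)
  finally show ?thesis unfolding comm r_def by (simp add: add_divide_distrib diff_divide_distrib)
qed

text \<open>The matrix positions fall into four classes relative to \<open>a\<close>: the entry at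
  \<open>a\<close>, the other diagonal entries, the \<open>2 * (N - 1)\<close> other entries in its
  row and column, and the \<open>(N - 1) * (N - 2)\<close> remaining off-diagonal ones. Each class
  has a single expectation.\<close>

lemma E_frobenius_relation:
  assumes d: "distinct [a,k,l]" and N: "N = real CARD('m)"
  shows "mom [a,a,a,a] + (N - 1) * mom [a,a,k,k]
      + 2 * (N - 1) * ((mom [a,a,a,a] - mom [a,a,k,k]) / 8
        + (2 * mom [a,a,a,a] - 8 * mom [a,a,a,k] + 6 * mom [a,a,k,k]) / 48)
      + (N - 1) * (N - 2) * ((mom [a,a,k,k] - mom [a,a,k,l]) / 2) = psum b 2 * mom [a,a]"
proof -
  define F where "F i j = E (\<lambda>S. q a S ^ 2 * conj_diag b i j S ^ 2)" for i j
  define R where "R = (mom [a,a,a,a] - mom [a,a,k,k]) / 8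
        + (2 * mom [a,a,a,a] - 8 * mom [a,a,a,k] + 6 * mom [a,a,k,k]) / 48"
  define T where "T = (mom [a,a,k,k] - mom [a,a,k,l]) / 2"
  have Faa: "F a a = mom [a,a,a,a]"
    by (simp add: F_def power2_eq_square mult.assoc)
  have Fii: "F i i = mom [a,a,k,k]" if "i \<noteq> a" for i
  proof -
    have "F i i = mom [a,a,i,i]" by (simp add: F_def power2_eq_square mult.assoc)
    also have "\<dots> = mom [a,a,k,k]" by (rule mom_22) (use d that in auto)
    finally show ?thesis .
  qed
  have Fai: "F a i = R" if "i \<noteq> a" for i
  proof -
    have "mom [a,a,i,i] = mom [a,a,k,k]" by (rule mom_22) (use d that in auto)
    moreover have "mom [a,a,a,i] = mom [a,a,a,k]" by (rule mom_31) (use d that in auto)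
    moreover have "distinct [a,i]" using that by simp
    ultimately show ?thesis unfolding F_def R_def by (simp only: E_diag_offdiag_common)
  qed
  have Fia: "F i a = R" if "i \<noteq> a" for i
    using Fai[OF that] by (simp add: F_def conj_diag_def mult_ac)
  have Fij: "F i j = T" if "distinct [a,i,j]" for i j
  proof -
    have "mom [a,a,i,i] = mom [a,a,k,k]" by (rule mom_22) (use d that in auto)
    moreover have "mom [a,a,i,j] = mom [a,a,k,l]" by (rule mom_211) (use d that in auto)
    ultimately show ?thesis unfolding F_def T_def by (simp only: E_diag_offdiag_disjoint[OF that])
  qed
  have "(\<Sum>j\<in>UNIV. F a j) = (\<Sum>j::'m\<in>UNIV. R) + (\<Sum>j\<in>{a}. F a j - R)"
    by (rule sum_split_exceptions) (simp add: Fai)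
  then have rowa: "(\<Sum>j\<in>UNIV. F a j) = mom [a,a,a,a] + (N - 1) * R"
    by (simp add: Faa N algebra_simps)
  have rowi: "(\<Sum>j\<in>UNIV. F i j) = R + mom [a,a,k,k] + (N - 2) * T" if "i \<noteq> a" for i
  proof -
    have "(\<Sum>j\<in>UNIV. F i j) = (\<Sum>j::'m\<in>UNIV. T) + (\<Sum>j\<in>{a,i}. F i j - T)"
      by (rule sum_split_exceptions) (rule Fij, use that in auto)
    then show ?thesis using that by (simp add: Fia Fii N algebra_simps)
  qed
  have "(\<Sum>i\<in>UNIV. \<Sum>j\<in>UNIV. F i j) = (\<Sum>i::'m\<in>UNIV. R + mom [a,a,k,k] + (N - 2) * T)
      + (\<Sum>i\<in>{a}. (\<Sum>j\<in>UNIV. F i j) - (R + mom [a,a,k,k] + (N - 2) * T))"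
    by (rule sum_split_exceptions) (rule rowi, simp)
  also have "\<dots> = mom [a,a,a,a] + (N - 1) * mom [a,a,k,k] + 2 * (N - 1) * R + (N - 1) * (N - 2) * T"
    by (simp add: rowa N[symmetric] algebra_simps)
  finally have lhs: "(\<Sum>i\<in>UNIV. \<Sum>j\<in>UNIV. F i j) = \<dots>" .
  have "(\<Sum>i\<in>UNIV. \<Sum>j\<in>UNIV. F i j) = E (\<lambda>S. \<Sum>i\<in>UNIV. \<Sum>j\<in>UNIV. q a S ^ 2 * conj_diag b i j S ^ 2)"
    unfolding F_def by (simp add: E_sum continuous_intros continuous_on_conj_diag)
  also have "\<dots> = E (\<lambda>S. psum b 2 * q a S ^ 2)"
    by (rule Bochner_Integration.integral_cong[OF refl])
      (simp add: space_H flip: sum_conj_diag_squares sum_distrib_left)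
  also have "\<dots> = psum b 2 * mom [a,a]"
    by (simp add: power2_eq_square)
  finally show ?thesis unfolding lhs R_def T_def .
qed

end

section \<open>Moments of the centered sum over both spectra\<close>

lemma E_bilinear_2:
  fixes a b :: "'m \<Rightarrow> real"
  assumes ab: "(\<Sum>i\<in>UNIV. a i) = 0" "(\<Sum>i\<in>UNIV. b i) = 0" and N: "N = real CARD('m)" "N > 1"
  shows "E (\<lambda>S. (\<Sum>i\<in>UNIV. a i * conj_diag b i i S) ^ 2) = 2 * psum a 2 * psum b 2 / ((N - 1) * (N + 2))"
proof -
  interpret centered_moments "\<lambda>is. E (\<lambda>S. \<Prod>i\<leftarrow>is. conj_diag b i i S)"
    by (rule centered_moments_conj_diag[OF ab(2)])
  obtain i j :: 'm where d: "distinct [i,j]"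
    using N ex_distinct_2[where 'i='m] by auto
  have "E (\<lambda>S. \<Prod>i\<leftarrow>[i,i]. conj_diag b i i S) = 2 * psum b 2 / (N * (N + 2))"
    using E_conj_diag_2[OF ab(2) N, of i] by (simp add: power2_eq_square)
  then have "E (\<lambda>S. (\<Sum>i\<in>UNIV. a i * conj_diag b i i S) ^ 2) = N / (N - 1) * (2 * psum b 2 / (N * (N + 2))) * psum a 2"
    by (subst E_sum_power2, intro continuous_on_conj_diag)
      (simp only: quadratic_form_centered[OF ab(1) d N])
  then show ?thesis using N(2) by simp
qed

lemma E_bilinear_3:
  fixes a b :: "'m \<Rightarrow> real"
  assumes ab: "(\<Sum>i\<in>UNIV. a i) = 0" "(\<Sum>i\<in>UNIV. b i) = 0" and N: "N = real CARD('m)" "N > 2"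
  shows "E (\<lambda>S. (\<Sum>i\<in>UNIV. a i * conj_diag b i i S) ^ 3) =
    8 * N * psum a 3 * psum b 3 / ((N - 1) * (N - 2) * (N + 2) * (N + 4))"
proof -
  interpret centered_moments "\<lambda>is. E (\<lambda>S. \<Prod>i\<leftarrow>is. conj_diag b i i S)"
    by (rule centered_moments_conj_diag[OF ab(2)])
  obtain i j k :: 'm where d: "distinct [i,j,k]"
    using N ex_distinct_3[where 'i='m] by auto
  have "E (\<lambda>S. \<Prod>i\<leftarrow>[i,i,i]. conj_diag b i i S) = 8 * psum b 3 / (N * (N + 2) * (N + 4))"
    using E_conj_diag_3[OF ab(2) N, of i] by (simp add: power3_eq_cube mult.assoc)
  then have "E (\<lambda>S. (\<Sum>i\<in>UNIV. a i * conj_diag b i i S) ^ 3) =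
      N^2 / ((N - 1) * (N - 2)) * (8 * psum b 3 / (N * (N + 2) * (N + 4))) * psum a 3"
    by (subst E_sum_power3, intro continuous_on_conj_diag)
      (simp only: cubic_form_centered[OF ab(1) d N])
  then show ?thesis using N(2) by (simp add: power2_eq_square mult_ac)
qed

text \<open>Although \<open>a\<close> enters as weights and \<open>b\<close> through the matrix, the
  result is symmetric in the two, as exchanging \<open>A\<close> with \<open>C\<close> and
  \<open>B\<close> with \<open>D\<close> shows.\<close>

lemma E_bilinear_4:
  fixes a b :: "'m \<Rightarrow> real"
  assumes ab: "(\<Sum>i\<in>UNIV. a i) = 0" "(\<Sum>i\<in>UNIV. b i) = 0" and N: "N = real CARD('m)" "N > 3"
  defines "A \<equiv> psum a 4" and "B \<equiv> (psum a 2)^2" and "C \<equiv> psum b 4" and "D \<equiv> (psum b 2)^2"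
  shows "E (\<lambda>S. (\<Sum>i\<in>UNIV. a i * conj_diag b i i S) ^ 4) =
    12 * (4 * N^2 * (N^2 + N + 2) * A * C + (N^4 + 5 * N^3 - 6 * N^2 - 36 * N + 72) * B * D
      - 4 * N * (2 * N^2 + 3 * N - 6) * (A * D + B * C)) /
    (N * (N + 1) * (N - 1) * (N - 2) * (N - 3) * (N + 2) * (N + 4) * (N + 6))"
proof -
  interpret centered_moments "\<lambda>is. E (\<lambda>S. \<Prod>i\<leftarrow>is. conj_diag b i i S)"
    by (rule centered_moments_conj_diag[OF ab(2)])
  obtain i j k l :: 'm where d: "distinct [i,j,k,l]"
    using N ex_distinct_4[where 'i='m] by auto
  define X where "X = E (\<lambda>S. (\<Sum>i\<in>UNIV. a i * conj_diag b i i S) ^ 4)"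
  define M where "M = (48 * C + 12 * D) / (N * (N + 2) * (N + 4) * (N + 6))"
  define K where "K = 2 * D / (N * (N + 2))"
  have M: "M = E (\<lambda>S. \<Prod>i\<leftarrow>[i,i,i,i]. conj_diag b i i S)"
    using E_conj_diag_4[OF ab(2) N, of i] by (simp add: M_def C_def D_def power4_eq_xxxx mult.assoc)
  have d3: "distinct [i,j,k]" using d by simp
  have "E (\<lambda>S. \<Prod>i\<leftarrow>[i,i]. conj_diag b i i S) = 2 * psum b 2 / (N * (N + 2))"
    using E_conj_diag_2[OF ab(2) N(1), of i] N(2) by (simp add: power2_eq_square)
  then have K: "psum b 2 * E (\<lambda>S. \<Prod>i\<leftarrow>[i,i]. conj_diag b i i S) = K"
    by (simp add: K_def D_def power2_eq_square)
  have "(N + 1) * (N - 1) * (N - 2) * (N - 3) * X =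
    (N^2 * (N^2 + N + 2) * M - 6 * N * (N - 1) * K) * A
    + (6 * (N^2 - 3 * N + 3) * K - N * (2 * N^2 + 3 * N - 6) * M) * B"
    unfolding X_def A_def B_def
    by (subst E_sum_power4, intro continuous_on_conj_diag)
      (rule quartic_form_centered[OF ab(1) d N M], unfold M, rule E_frobenius_relation[OF ab(2) d3 N(1), unfolded K])
  \<comment> \<open>Clears the denominators of \<open>M\<close> and \<open>K\<close>, so that
    \<open>algebra\<close> can compare polynomials.\<close>
  then have "N * (N + 2) * (N + 4) * (N + 6) * ((N + 1) * (N - 1) * (N - 2) * (N - 3) * X) =
    (N^2 * (N^2 + N + 2) * (N * (N + 2) * (N + 4) * (N + 6) * M)
      - 6 * N * (N - 1) * (N + 4) * (N + 6) * (N * (N + 2) * K)) * A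
    + (6 * (N^2 - 3 * N + 3) * (N + 4) * (N + 6) * (N * (N + 2) * K)
      - N * (2 * N^2 + 3 * N - 6) * (N * (N + 2) * (N + 4) * (N + 6) * M)) * B"
    by algebra
  also have "N * (N + 2) * (N + 4) * (N + 6) * M = 48 * C + 12 * D"
    using N(2) by (simp add: M_def)
  also have "N * (N + 2) * K = 2 * D"
    using N(2) by (simp add: K_def)
  also have "(N^2 * (N^2 + N + 2) * (48 * C + 12 * D) - 6 * N * (N - 1) * (N + 4) * (N + 6) * (2 * D)) * A
    + (6 * (N^2 - 3 * N + 3) * (N + 4) * (N + 6) * (2 * D) - N * (2 * N^2 + 3 * N - 6) * (48 * C + 12 * D)) * B =
    12 * (4 * N^2 * (N^2 + N + 2) * A * C + (N^4 + 5 * N^3 - 6 * N^2 - 36 * N + 72) * B * D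
      - 4 * N * (2 * N^2 + 3 * N - 6) * (A * D + B * C))"
    by algebra
  finally have eq: "X * (N * (N + 1) * (N - 1) * (N - 2) * (N - 3) * (N + 2) * (N + 4) * (N + 6)) = \<dots>"
    by (simp add: mult_ac)
  have "N * (N + 1) * (N - 1) * (N - 2) * (N - 3) * (N + 2) * (N + 4) * (N + 6) \<noteq> 0"
    using N(2) by simp
  from nonzero_eq_divide_eq[THEN iffD2, OF this eq] show ?thesis
    unfolding X_def .
qed

end

section \<open>Moments of CV\<close>

lemma CV_expand:
  fixes U V :: "real^'m^'n" and T :: "real^'m^'m"
  defines "S \<equiv> transpose V ** U ** T"
  shows "CV U l V m T = (\<Sum>i\<in>UNIV. m $ i * conj_diag (($) l) i i S)"
proof -
  have "CV U l V m T = trace ((U ** T ** diag l ** transpose T ** transpose U ** V ** diag m) ** transpose V)"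
    by (simp add: CV_def matrix_mul_assoc)
  also have "\<dots> = trace (transpose V ** (U ** T ** diag l ** transpose T ** transpose U ** V ** diag m))"
    by (rule trace_mul_sym)
  also have "\<dots> = trace ((S ** diag l ** transpose S) ** diag m)"
    by (simp add: S_def matrix_transpose_mul matrix_mul_assoc)
  also have "\<dots> = (\<Sum>i\<in>UNIV. m $ i * conj_diag (($) l) i i S)"
  proof -
    have "(A ** diag v) $ i $ j = A $ i $ j * v $ j" for A :: "real^'m^'m" and v i j
      by (simp add: matrix_matrix_mult_def diag_def if_distrib[of "\<lambda>x. _ * x"] cong: if_cong)
    moreover have "(S ** diag l ** transpose S) $ i $ i = conj_diag (($) l) i i S" for i
      unfolding matrix_matrix_mult_def[of "S ** diag l"]
      by (simp add: calculation conj_diag_def transpose_def mult_ac)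
    ultimately show ?thesis by (simp add: trace_def mult.commute)
  qed
  finally show ?thesis .
qed

context haar
begin

text \<open>By exchangeability each diagonal entry has as its mean an equal share of the constant
  trace; no centering is involved.\<close>

lemma E_diag_moment_1:
  fixes a b :: "'m \<Rightarrow> real"
  shows "E (\<lambda>S. \<Sum>i\<in>UNIV. a i * conj_diag b i i S) = psum a 1 * psum b 1 / real CARD('m)"
proof -
  interpret exchangeable_moments "\<lambda>is. E (\<lambda>S. \<Prod>i\<leftarrow>is. conj_diag b i i S)" "psum b 1"
    by (rule exchangeable_moments_conj_diag)
  have "E (\<lambda>S. conj_diag b i i S) = psum b 1 / real CARD('m)" for i
    using N_mom_1[of i] by (simp add: field_simps)
  then show ?thesis
    by (simp add: E_sum continuous_intros continuous_on_conj_diag flip: sum_divide_distrib sum_distrib_right)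
qed

end

theorem theorem1:
  fixes f :: "real^'n"
    and KX KY :: "real^'n^'n"
    and U V :: "real^('m::{finite,linorder})^'n"
    and lam mu :: "real^('m::{finite,linorder})"
    and M :: "'a measure"
    and T :: "'a \<Rightarrow> real^('m::{finite,linorder})^('m::{finite,linorder})"
    and n :: real
    and E :: "('a \<Rightarrow> real) \<Rightarrow> real"
    and cv cvc :: "'a \<Rightarrow> real"
    and l m :: "nat \<Rightarrow> real"
  assumes "weights f"
    and "standard_kernel f KX" and "nontrivial_eigendecomposition f KX U lam"
    and "standard_kernel f KY" and "nontrivial_eigendecomposition f KY V mu"
    and "prob_space M" and "haar_distributed M T"
  defines "n \<equiv> real CARD('n)"
    and "E \<equiv> integral\<^sup>L M"
    and "cv \<equiv> (\<lambda>\<omega>. CV U lam V mu (T \<omega>))"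
    and "cvc \<equiv> (\<lambda>\<omega>. cv \<omega> - E cv)"
    and "l \<equiv> centered_spectral_moment lam"
    and "m \<equiv> centered_spectral_moment mu"
  shows "(n \<ge> 2 \<longrightarrow>
            E cv = (n - 1) * spectral_moment lam 1 * spectral_moment mu 1) \<and>
         (n \<ge> 3 \<longrightarrow>
            E (\<lambda>\<omega>. cvc \<omega> ^ 2) = 2 * (n - 1)^2 / ((n - 2) * (n + 1)) * l 2 * m 2) \<and>
         (n \<ge> 4 \<longrightarrow>
            E (\<lambda>\<omega>. cvc \<omega> ^ 3) =
              8 * (n - 1)^3 / ((n - 3) * (n - 2) * (n + 1) * (n + 3)) * l 3 * m 3) \<and>
         (n \<ge> 5 \<longrightarrow>
            E (\<lambda>\<omega>. cvc \<omega> ^ 4) =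
              12 * (n - 1)^3 /
                ((n - 4) * (n - 3) * (n - 2) * n * (n + 1) * (n + 3) * (n + 5)) *
              (4 * (n^2 - n + 2) * l 4 * m 4
               + (n^4 + n^3 - 15 * n^2 - 13 * n + 98) * (l 2)^2 * (m 2)^2
               - 4 * (2 * n^2 - n - 7) * (l 4 * (m 2)^2 + (l 2)^2 * m 4)))"
proof -
  define N where "N = real CARD('m)"
  have n: "n = N + 1" and N0: "N > 0"
    using assms(3) by (simp_all add: n_def N_def nontrivial_eigendecomposition_def)
  define H where "H = distr M orthogonal_borel T"
  interpret haar H
    using assms(7) by (unfold_locales) (simp add: H_def haar_distributed_def)
  have T: "T \<in> measurable M orthogonal_borel"
    using assms(7) by (simp add: haar_distributed_def)
  define W where "W = transpose V ** U"
  \<comment> \<open>The columns of \<open>U\<close> and of \<open>V\<close> are orthonormal bases of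
    the same space, the complement of \<open>sqrt_vec f\<close>, so \<open>W\<close> is the change
    of basis. Left invariance then absorbs it.\<close>
  have W: "orthogonal_matrix W"
  proof -
    have U: "transpose U ** U = mat 1" "U ** transpose U = V ** transpose V"
      and V: "transpose V ** V = mat 1"
      using assms(3,5) by (simp_all add: nontrivial_eigendecomposition_def)
    have "W ** transpose W = transpose V ** (U ** transpose U) ** V"
      by (simp add: W_def matrix_transpose_mul matrix_mul_assoc)
    also have "\<dots> = (transpose V ** V) ** (transpose V ** V)"
      unfolding U by (simp add: matrix_mul_assoc)
    finally have "orthogonal_matrix (transpose W)"
      by (simp add: orthogonal_matrix V)
    then show ?thesis by simp
  qed
  have E: "E (\<lambda>\<omega>. g (W ** T \<omega>)) = integral\<^sup>L H g" if "continuous_on UNIV g" for g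
  proof -
    have "continuous_on UNIV (\<lambda>S. g (W ** S))"
      unfolding matrix_matrix_mult_def
      by (intro continuous_on_compose2[OF that] continuous_intros) auto
    then have "(\<lambda>S. g (W ** S)) \<in> borel_measurable orthogonal_borel"
      using measurable_H by (simp cong: measurable_cong_sets add: sets_H)
    from integral_distr[OF T this] show ?thesis
      using E_left[OF that W] by (simp add: E_def H_def)
  qed
  define a where "a i = mu $ i - spectral_moment mu 1" for i
  define b where "b j = lam $ j - spectral_moment lam 1" for j
  have ab: "(\<Sum>i\<in>UNIV. a i) = 0" "(\<Sum>j\<in>UNIV. b j) = 0"
    by (simp_all add: a_def b_def sum_subtractf spectral_moment_def)
  have lm: "l q = psum b q / N" "m q = psum a q / N" for q
    by (simp_all add: l_def m_def centered_spectral_moment_def a_def b_def N_def)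
  have cv: "cv = (\<lambda>\<omega>. \<Sum>i\<in>UNIV. mu $ i * conj_diag (($) lam) i i (W ** T \<omega>))"
    unfolding cv_def CV_expand W_def ..
  have Ecv: "E cv = N * spectral_moment lam 1 * spectral_moment mu 1"
    unfolding cv using N0
    by (subst E) (auto intro!: continuous_intros continuous_on_conj_diag
        simp: E_diag_moment_1 spectral_moment_def N_def)
  have T_orth: "orthogonal_matrix (W ** T \<omega>)" if "\<omega> \<in> space M" for \<omega>
    using measurable_space[OF T that] W
    by (simp add: orthogonal_borel_def space_restrict_space orthogonal_matrix_mul)
  \<comment> \<open>Centering \<open>lam\<close> shifts every diagonal entry by the same constant,
    since the rows of \<open>S\<close> are unit vectors; centering \<open>mu\<close> then changes
    nothing, since the shifted entries sum to zero. The total shift is exactly the mean.\<close>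
  have cvc: "cvc \<omega> = (\<Sum>i\<in>UNIV. a i * conj_diag b i i (W ** T \<omega>))" if "\<omega> \<in> space M" for \<omega>
  proof -
    define S where "S = W ** T \<omega>"
    have S: "orthogonal_matrix S" unfolding S_def by (rule T_orth[OF that])
    have 1: "conj_diag b i i S = conj_diag (($) lam) i i S - spectral_moment lam 1" for i
    proof -
      have "(\<Sum>j\<in>UNIV. S $ i $ j * S $ i $ j) = 1"
        using orthogonal_matrix_columns[of "transpose S" i i, unfolded orthogonal_matrix_transpose, OF S]
        by (simp add: transpose_def)
      then show ?thesis
        by (simp add: conj_diag_def b_def algebra_simps sum_subtractf flip: sum_distrib_left)
    qed
    have "(\<Sum>i\<in>UNIV. a i * conj_diag b i i S) = (\<Sum>i\<in>UNIV. mu $ i * conj_diag b i i S)"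
      using sum_conj_diag[OF S, of b] ab(2)
      by (simp add: a_def left_diff_distrib sum_subtractf flip: sum_distrib_left)
    also have "\<dots> = cv \<omega> - spectral_moment lam 1 * (\<Sum>i\<in>UNIV. mu $ i)"
      unfolding cv S_def[symmetric]
      by (simp add: 1 right_diff_distrib sum_subtractf sum_distrib_left mult.commute)
    also have "(\<Sum>i\<in>UNIV. mu $ i) = N * spectral_moment mu 1"
      using N0 by (simp add: spectral_moment_def N_def)
    finally show ?thesis by (simp add: cvc_def Ecv S_def)
  qed
  have Ecvc: "E (\<lambda>\<omega>. cvc \<omega> ^ q) = integral\<^sup>L H (\<lambda>S. (\<Sum>i\<in>UNIV. a i * conj_diag b i i S) ^ q)" for q
  proof -
    have "E (\<lambda>\<omega>. cvc \<omega> ^ q) = E (\<lambda>\<omega>. (\<Sum>i\<in>UNIV. a i * conj_diag b i i (W ** T \<omega>)) ^ q)"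
      unfolding E_def by (rule Bochner_Integration.integral_cong[OF refl]) (simp add: cvc)
    also have "\<dots> = integral\<^sup>L H (\<lambda>S. (\<Sum>i\<in>UNIV. a i * conj_diag b i i S) ^ q)"
      by (rule E) (intro continuous_intros continuous_on_conj_diag)
    finally show ?thesis .
  qed
  have shift: "n - 1 = N" "n - 2 = N - 1" "n - 3 = N - 2" "n + 1 = N + 2" "n + 3 = N + 4"
    by (simp_all add: n)
  have 2: "E (\<lambda>\<omega>. cvc \<omega> ^ 2) = 2 * (n - 1)^2 / ((n - 2) * (n + 1)) * l 2 * m 2" if "n \<ge> 3"
    unfolding Ecvc lm shift using that N0
    by (subst E_bilinear_2[OF ab N_def]) (auto simp: n power2_eq_square mult_ac)
  have 3: "E (\<lambda>\<omega>. cvc \<omega> ^ 3) = 8 * (n - 1)^3 / ((n - 3) * (n - 2) * (n + 1) * (n + 3)) * l 3 * m 3"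
    if "n \<ge> 4"
    unfolding Ecvc lm shift using that N0
    by (subst E_bilinear_3[OF ab N_def]) (auto simp: n power3_eq_cube mult_ac)
  have 4: "E (\<lambda>\<omega>. cvc \<omega> ^ 4) = 12 * (n - 1)^3 /
                ((n - 4) * (n - 3) * (n - 2) * n * (n + 1) * (n + 3) * (n + 5)) *
              (4 * (n^2 - n + 2) * l 4 * m 4
               + (n^4 + n^3 - 15 * n^2 - 13 * n + 98) * (l 2)^2 * (m 2)^2
               - 4 * (2 * n^2 - n - 7) * (l 4 * (m 2)^2 + (l 2)^2 * m 4))" if "n \<ge> 5"
  proof -
    define A where "A = psum a 4"
    \<comment> \<open>Unlike in \<open>E_bilinear_4\<close>, \<open>B\<close> and \<open>D\<close>
      are the power sums themselves, not their squares.\<close>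
    define B where "B = psum a 2"
    define C where "C = psum b 4"
    define D where "D = psum b 2"
    define G where "G = (N - 3) * (N - 2) * (N - 1) * (N + 1) * (N + 2) * (N + 4) * (N + 6)"
    \<comment> \<open>Turning power sums into averages over \<open>N\<close> eigenvalues absorbs one
      factor \<open>N\<close> of the denominator and leaves \<open>N^3\<close> in front.\<close>
    have scale: "X / (N * G) = Y / G" if "X = N * Y" for X Y
      using that N0 by simp
    have "N > 3" using that n by simp
    from E_bilinear_4[OF ab N_def this]
    have "E (\<lambda>\<omega>. cvc \<omega> ^ 4) = 12 * (4 * N^2 * (N^2 + N + 2) * A * C + (N^4 + 5 * N^3 - 6 * N^2 - 36 * N + 72) * B^2 * D^2
      - 4 * N * (2 * N^2 + 3 * N - 6) * (A * D^2 + B^2 * C)) / (N * G)"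
      unfolding Ecvc A_def B_def C_def D_def G_def by (simp add: mult_ac)
    also have "\<dots> = 12 * N^3 / G * (4 * (N^2 + N + 2) * (C / N) * (A / N)
       + (N^4 + 5 * N^3 - 6 * N^2 - 36 * N + 72) * (D / N)^2 * (B / N)^2
       - 4 * (2 * N^2 + 3 * N - 6) * ((C / N) * (B / N)^2 + (D / N)^2 * (A / N)))"
      by (subst times_divide_eq_left, rule scale) (use N0 in \<open>simp add: field_simps eval_nat_numeral\<close>)
    also have "G = (n - 4) * (n - 3) * (n - 2) * n * (n + 1) * (n + 3) * (n + 5)"
      by (simp add: G_def n algebra_simps)
    also have "N^2 + N + 2 = n^2 - n + 2"
      unfolding n by algebra
    also have "N^4 + 5 * N^3 - 6 * N^2 - 36 * N + 72 = n^4 + n^3 - 15 * n^2 - 13 * n + 98"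
      unfolding n by algebra
    also have "2 * N^2 + 3 * N - 6 = 2 * n^2 - n - 7"
      unfolding n by algebra
    also have "N = n - 1" by (simp add: n)
    finally show ?thesis
      unfolding A_def[symmetric] B_def[symmetric] C_def[symmetric] D_def[symmetric] lm by (simp add: n)
  qed
  show ?thesis using Ecv 2 3 4 by (simp add: n)
qed

end
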